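(* Let $d\ge 1$, let $\mathbf{p}=(p_1,\dots,p_d)$ be a vector of nonzero real numbers, and let $\boldsymbol\pi=(\pi_2,\dots,\pi_d)$, where each $\pi_i$ is a permutation of $\{0,\dots,i-1\}$. Then the collection $\mathcal{T}_d(\mathbf{p},\boldsymbol\pi)$ constructed below is a simplicial tessellation of $\mathbb{R}^d$; every simplex $K\in\mathcal{T}_d(\mathbf{p},\boldsymbol\pi)$ satisfies $$\operatorname{meas}_d K=\prod_{i=1}^d |p_i|;$$ and every connected compact subset of the tessellation (i.e. every finite subcollection of its simplices whose union is connected) is a face-to-face mesh.
   Context: Construction. Inductively, for $m=1,\dots,d$, define a collection $\mathcal{T}_m$ of $m$-simplices in $\mathbb{R}^m$ with a coloring $c_m$ of their vertices by colors in $\{0,\dots,m\}$. (i) $m=1$: vertices $A_z=zp_1$, $z\in\mathbb{Z}$; simplices are the segments between $zp_1$ and $(z+1)p_1$; $c_1(A_z)=z \bmod 2$. (ii) Step $m-1\to m$ ($2\le m\le d$): put $c'=\pi_m\circ c_{m-1}$. For each $K\in\mathcal{T}_{m-1}$ label its vertices $A_0,\dots,A_{m-1}$ so that $c'(A_i)=i$. For $j\in\mathbb{Z}$ let $B^K_j=(A_{j\bmod m},\, jp_m)\in\mathbb{R}^m$, and for $z\in\mathbb{Z}$ let $L^{K,z}=\operatorname{conv}\{B^K_z,\dots,B^K_{z+m}\}$. Set $\mathcal{T}_m=\{L^{K,z}:K\in\mathcal{T}_{m-1},z\in\mathbb{Z}\}$. Its vertices are the points $(A,jp_m)$ with $A$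 a vertex of $\mathcal{T}_{m-1}$ and $j\equiv c'(A)\pmod m$, colored by $c_m((A,jp_m))=j\bmod(m+1)$. Then $\mathcal{T}_d(\mathbf{p},\boldsymbol\pi):=\mathcal{T}_d$. A simplicial tessellation of $\mathbb{R}^d$ is a collection of $d$-simplices covering $\mathbb{R}^d$ with pairwise disjoint interiors. A collection of simplices is a face-to-face mesh if any two of its simplices intersect either in the empty set or in a common face of both. $\operatorname{meas}_d$ is $d$-dimensional Lebesgue measure. *)

theory Defs
  imports "HOL-Analysis.Analysis" "HOL-Combinatorics.Permutations"
begin

text \<open>Points of R^m are represented as functions nat => real vanishing outside {..<m};
  coordinate k (0-based) of a point is the paper's coordinate k+1.\<close>

definition Rd :: "nat \<Rightarrow> (nat \<Rightarrow> real) set" where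
  "Rd m = {x. \<forall>i\<ge>m. x i = 0}"

definition conv_pts :: "(nat \<Rightarrow> real) set \<Rightarrow> (nat \<Rightarrow> real) set" where
  "conv_pts V = {x. \<exists>u. (\<forall>v\<in>V. 0 \<le> u v) \<and> sum u V = 1 \<and> x = (\<lambda>i. \<Sum>v\<in>V. u v * v i)}"

definition aff_indep_pts :: "(nat \<Rightarrow> real) set \<Rightarrow> bool" where
  "aff_indep_pts V \<longleftrightarrow> (\<forall>u. sum u V = 0 \<and> (\<forall>i. (\<Sum>v\<in>V. u v * v i) = 0) \<longrightarrow> (\<forall>v\<in>V. u v = 0))"

definition is_simplex :: "nat \<Rightarrow> (nat \<Rightarrow> real) set \<Rightarrow> bool" where
  "is_simplex d K \<longleftrightarrow> (\<exists>V. finite V \<and> card V = d + 1 \<and> V \<subseteq> Rd d \<and> aff_indep_pts V \<and> K = conv_pts V)"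

definition simplex_face :: "(nat \<Rightarrow> real) set \<Rightarrow> (nat \<Rightarrow> real) set \<Rightarrow> bool" where
  "simplex_face F K \<longleftrightarrow> (\<exists>V W. finite V \<and> aff_indep_pts V \<and> K = conv_pts V \<and>
       W \<subseteq> V \<and> W \<noteq> {} \<and> F = conv_pts W)"

text \<open>Interior of a set relative to R^d (product topology on nat => real restricted to R^d,
  which is the Euclidean topology of R^d).\<close>
definition int_d :: "nat \<Rightarrow> (nat \<Rightarrow> real) set \<Rightarrow> (nat \<Rightarrow> real) set" where
  "int_d d K = \<Union>{U. openin (top_of_set (Rd d)) U \<and> U \<subseteq> K}"

definition meas_d :: "nat \<Rightarrow> (nat \<Rightarrow> real) set \<Rightarrow> ennreal" where
  "meas_d d K = emeasure (Pi\<^sub>M {..<d} (\<lambda>_. lborel)) ((\<lambda>x. restrict x {..<d}) ` K)"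

definition simplicial_tessellation :: "nat \<Rightarrow> (nat \<Rightarrow> real) set set \<Rightarrow> bool" where
  "simplicial_tessellation d T \<longleftrightarrow>
     (\<forall>K\<in>T. is_simplex d K) \<and> \<Union>T = Rd d \<and>
     (\<forall>K\<in>T. \<forall>L\<in>T. K \<noteq> L \<longrightarrow> int_d d K \<inter> int_d d L = {})"

definition face_to_face :: "(nat \<Rightarrow> real) set set \<Rightarrow> bool" where
  "face_to_face S \<longleftrightarrow> (\<forall>K\<in>S. \<forall>L\<in>S. K \<inter> L = {} \<or> (simplex_face (K \<inter> L) K \<and> simplex_face (K \<inter> L) L))"

text \<open>Coloring c_m of the vertices of T_m (m >= 1): the vertex (A, j p_m) gets color j mod (m+1);
  for m = 1 the vertex z p_1 gets z mod 2.\<close>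
definition vcol :: "(nat \<Rightarrow> real) \<Rightarrow> nat \<Rightarrow> (nat \<Rightarrow> real) \<Rightarrow> nat" where
  "vcol p m x = nat (round (x (m - 1) / p m) mod (int m + 1))"

definition lab_vtx :: "(nat \<Rightarrow> real) \<Rightarrow> (nat \<Rightarrow> nat \<Rightarrow> nat) \<Rightarrow> nat \<Rightarrow> (nat \<Rightarrow> real) set \<Rightarrow> nat \<Rightarrow> (nat \<Rightarrow> real)" where
  "lab_vtx p \<pi> m K i = (THE A. A \<in> K \<and> \<pi> m (vcol p (m - 1) A) = i)"

fun tess_vs :: "(nat \<Rightarrow> real) \<Rightarrow> (nat \<Rightarrow> nat \<Rightarrow> nat) \<Rightarrow> nat \<Rightarrow> (nat \<Rightarrow> real) set set" where
  "tess_vs p \<pi> 0 = {}"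
| "tess_vs p \<pi> (Suc 0) =
     {{(\<lambda>i. if i = 0 then real_of_int z * p 1 else 0),
       (\<lambda>i. if i = 0 then real_of_int (z + 1) * p 1 else 0)} | z::int. True}"
| "tess_vs p \<pi> (Suc (Suc k)) =
     {{(lab_vtx p \<pi> (Suc (Suc k)) K (nat (j mod int (Suc (Suc k)))))
          (Suc k := real_of_int j * p (Suc (Suc k))) | j::int. z \<le> j \<and> j \<le> z + int (Suc (Suc k))}
      | K z. K \<in> tess_vs p \<pi> (Suc k)}"

definition tess :: "(nat \<Rightarrow> real) \<Rightarrow> (nat \<Rightarrow> nat \<Rightarrow> nat) \<Rightarrow> nat \<Rightarrow> (nat \<Rightarrow> real) set set" where
  "tess p \<pi> d = conv_pts ` tess_vs p \<pi> d"

end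

theory Submission
  imports Defs
begin

text \<open>
  The step from dimension n to m = n + 1 lifts a simplex with vertices labelled \<open>A 0, ..., A n\<close> to
  the simplices spanned by m + 1 consecutive points \<open>B j = (A (j mod m), j q)\<close>. The first step
  is the same construction applied to the single point of dimension 0.

  The invariant is that a point has at most one system of nonnegative barycentric weights, the
  same in all simplices of the tessellation that contain it. The weights of a lifted point determine,
  by summation over residue classes, those of its projection, and their first moment in j
  is the last coordinate; a nonnegative weight system supported in a window of m + 1 consecutive
  integers is determined by its class sums and first moment, even if the window is not
  known. So uniqueness is inherited by the lifted tessellation. It yields affine
  independence, the face-to-face property, and the disjointness of the interiors (an interior point
  may be moved towards a vertex not shared by the other simplex).
\<close>

section \<open>Weights on windows of integers\<close>

definition residue :: "nat \<Rightarrow> int \<Rightarrow> nat" where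
  "residue m j = nat (j mod int m)"

lemma residue_less: "0 < m \<Longrightarrow> residue m j < m"
  by (simp add: residue_def nat_less_iff)

lemma residue_add_period [simp]: "residue m (z + int m) = residue m z"
  by (simp add: residue_def)

lemma residue_eq_iff: "0 < m \<Longrightarrow> residue m i = residue m j \<longleftrightarrow> int m dvd i - j"
  unfolding residue_def
  by (simp add: eq_nat_nat_iff mod_eq_dvd_iff)

lemma bij_betw_residue:
  assumes "0 < m"
  shows "bij_betw (residue m) {z..<z + int m} {..<m}"
proof -
  have inj: "inj_on (residue m) {z..<z + int m}"
  proof (rule inj_onI)
    fix i j assume ij: "i \<in> {z..<z + int m}" "j \<in> {z..<z + int m}" "residue m i = residue m j"
    then have "int m dvd i - j" using assms by (simp add: residue_eq_iff)
    moreover have "\<bar>i - j\<bar> < int m" using ij by auto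
    ultimately show "i = j" using dvd_imp_le_int[of "i - j" "int m"] by auto
  qed
  have "residue m ` {z..<z + int m} \<subseteq> {..<m}" using residue_less[OF assms] by auto
  moreover have "card (residue m ` {z..<z + int m}) = card {..<m}"
    using card_image[OF inj] by simp
  ultimately have "residue m ` {z..<z + int m} = {..<m}"
    by (intro card_subset_eq) auto
  with inj show ?thesis by (simp add: bij_betw_def)
qed

text \<open>The two end points of a window of m + 1 integers lie in the same class modulo m, and z
  together with the inner indices is a complete residue system. Sums and products over windows and
  over classes are compared through this splitting.\<close>

lemma window_eq: "0 < m \<Longrightarrow> {z..z + int m} = insert z (insert (z + int m) {z + 1..<z + int m})"
  by auto

lemma sum_window:
  assumes "0 < m"
  shows "(\<Sum>j\<in>{z..z + int m}. f j) = f z + f (z + int m) + (\<Sum>j\<in>{z + 1..<z + int m}. f j :: 'a::comm_monoid_add)"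
  using assms by (subst window_eq) (auto simp: add.assoc)

lemma prod_window:
  assumes "0 < m"
  shows "(\<Prod>j\<in>{z..z + int m}. f j) = f z * f (z + int m) * (\<Prod>j\<in>{z + 1..<z + int m}. f j :: 'a::comm_monoid_mult)"
  using assms by (subst window_eq) (auto simp: mult.assoc)

lemma sum_residue:
  assumes "0 < m"
  shows "(\<Sum>i<m. f i) = f (residue m z) + (\<Sum>j\<in>{z + 1..<z + int m}. f (residue m j) :: 'a::comm_monoid_add)"
proof -
  have "{z..<z + int m} = insert z {z + 1..<z + int m}" using assms by auto
  then show ?thesis
    using sum.reindex_bij_betw[OF bij_betw_residue[OF assms, of z], of f] by simp
qed

lemma prod_residue:
  assumes "0 < m"
  shows "(\<Prod>i<m. f i) = f (residue m z) * (\<Prod>j\<in>{z + 1..<z + int m}. f (residue m j) :: 'a::comm_monoid_mult)"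
proof -
  have "{z..<z + int m} = insert z {z + 1..<z + int m}" using assms by auto
  then show ?thesis
    using prod.reindex_bij_betw[OF bij_betw_residue[OF assms, of z], of f] by simp
qed

lemma all_residue:
  assumes "0 < m"
  shows "(\<forall>i<m. P i) \<longleftrightarrow> P (residue m z) \<and> (\<forall>j\<in>{z + 1..<z + int m}. P (residue m j))"
proof -
  have "{z..<z + int m} = insert z {z + 1..<z + int m}" using assms by auto
  then have "{..<m} = insert (residue m z) (residue m ` {z + 1..<z + int m})"
    using bij_betw_imp_surj_on[OF bij_betw_residue[OF assms, of z]] by simp
  then have "(\<forall>i\<in>{..<m}. P i) \<longleftrightarrow> P (residue m z) \<and> (\<forall>j\<in>{z + 1..<z + int m}. P (residue m j))"
    by (simp only: ball_simps)
  then show ?thesis by (simp only: Ball_def lessThan_iff)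
qed

section \<open>Weights determined by class sums and first moment\<close>

definition class_sum :: "nat \<Rightarrow> int set \<Rightarrow> (int \<Rightarrow> real) \<Rightarrow> nat \<Rightarrow> real" where
  "class_sum m S \<mu> i = (\<Sum>j | j \<in> S \<and> residue m j = i. \<mu> j)"

lemma sum_class_function:
  assumes "finite S" "0 < m"
  shows "(\<Sum>j\<in>S. g (residue m j) * \<mu> j) = (\<Sum>i<m. g i * class_sum m S \<mu> i)"
proof -
  have "(\<Sum>j\<in>S. g (residue m j) * \<mu> j) = (\<Sum>i<m. \<Sum>j | j \<in> S \<and> residue m j = i. g (residue m j) * \<mu> j)"
    using assms residue_less by (intro sum.group[symmetric]) auto
  also have "\<dots> = (\<Sum>i<m. g i * class_sum m S \<mu> i)"
    by (auto intro!: sum.cong simp: class_sum_def sum_distrib_left)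
  finally show ?thesis .
qed

text \<open>For positive m, this is the only element of {z + 1..z + m} congruent to i modulo
  m.\<close>

definition upper_rep :: "nat \<Rightarrow> int \<Rightarrow> nat \<Rightarrow> int" where
  "upper_rep m z i = z + 1 + (int i - z - 1) mod int m"

lemma upper_rep_residue:
  assumes "0 < m"
  shows "upper_rep m z (residue m j) = z + 1 + (j - z - 1) mod int m"
proof -
  have "(int (residue m j) - z - 1) mod int m = (j - z - 1) mod int m"
    using assms by (simp add: residue_def mod_diff_left_eq diff_diff_eq)
  then show ?thesis by (simp add: upper_rep_def)
qed

text \<open>Within the window only z lies outside {z + 1..z + m}, so only z moves, by m. The
  resulting change of the first moment isolates the weight at z.\<close>

lemma upper_rep_window:
  assumes "0 < m" "j \<in> {z..z + int m}"
  shows "upper_rep m z (residue m j) = (if j = z then z + int m else j)"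
proof -
  have "(-1) mod int m = int m - 1" using assms by (simp add: zmod_minus1)
  then show ?thesis using assms by (auto simp: upper_rep_residue)
qed

lemma upper_rep_le:
  assumes "0 < m" "z < j"
  shows "upper_rep m z (residue m j) \<le> j"
proof -
  have "(j - z - 1) mod int m \<le> j - z - 1" using assms by (intro zmod_le_nonneg_dividend) auto
  then show ?thesis using assms by (simp add: upper_rep_residue)
qed

text \<open>No two elements of {z + 1..z + m} are congruent, so at most one term of the class sum is
  nonzero. The value 0 is for index sets S that miss j.\<close>

lemma class_sum_upper_window:
  assumes m: "0 < m" and j: "j \<in> {z + 1..z + int m}" and S: "finite S"
    and supp: "\<And>k. k \<in> S \<Longrightarrow> \<mu> k \<noteq> 0 \<Longrightarrow> k \<in> {z + 1..z + int m}"
  shows "class_sum m S \<mu> (residue m j) = (if j \<in> S then \<mu> j else 0)"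
proof -
  have "\<mu> k = 0" if "k \<in> S" "residue m k = residue m j" "k \<noteq> j" for k
  proof (rule ccontr)
    assume "\<mu> k \<noteq> 0"
    then have k: "k \<in> {z + 1..z + int m}" using supp that by blast
    have "upper_rep m z (residue m k) = k" "upper_rep m z (residue m j) = j"
      using upper_rep_window[OF m, of k z] upper_rep_window[OF m, of j z] k j by auto
    then show False using that by simp
  qed
  then have "class_sum m S \<mu> (residue m j) = (\<Sum>k | k \<in> S \<and> residue m k = residue m j. if k = j then \<mu> j else 0)"
    unfolding class_sum_def by (auto intro!: sum.cong)
  also have "\<dots> = (if j \<in> S then \<mu> j else 0)"
    using S by (simp add: sum.delta)
  finally show ?thesis .
qed

text \<open>Replacing every index by its representative in \<open>{z + 1..z + m}\<close> can only raise the first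
  moment over the lower window and only lower it over the upper one; equality of the moments
  therefore confines both weight systems to \<open>{z + 1..z + m}\<close>, which meets each class once.\<close>

lemma window_weights_unique_less:
  fixes \<mu> \<mu>' :: "int \<Rightarrow> real"
  assumes m: "0 < m" and less: "z < z'"
    and nn: "\<And>j. j \<in> {z..z + int m} \<Longrightarrow> 0 \<le> \<mu> j" "\<And>j. j \<in> {z'..z' + int m} \<Longrightarrow> 0 \<le> \<mu>' j"
    and cls: "\<And>i. i < m \<Longrightarrow> class_sum m {z..z + int m} \<mu> i = class_sum m {z'..z' + int m} \<mu>' i"
    and mom: "(\<Sum>j\<in>{z..z + int m}. of_int j * \<mu> j) = (\<Sum>j\<in>{z'..z' + int m}. of_int j * \<mu>' j)"
  shows "(if j \<in> {z..z + int m} then \<mu> j else 0) = (if j \<in> {z'..z' + int m} then \<mu>' j else 0)"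
proof -
  let ?W = "{z..z + int m}" and ?W' = "{z'..z' + int m}"
  \<comment> \<open>Both windows use the representatives attached to the lower one. They depend only
    on the class, so equal class sums give equal moments after the replacement.\<close>
  let ?g = "\<lambda>j. real_of_int (upper_rep m z (residue m j))"
  have g: "?g j \<ge> of_int j" if "j \<in> ?W" for j using upper_rep_window[OF m that] by auto
  have g': "?g j \<le> of_int j" if "j \<in> ?W'" for j using upper_rep_le[OF m, of z j] that less by auto
  have "(\<Sum>j\<in>?W. ?g j * \<mu> j) = (\<Sum>j\<in>?W'. ?g j * \<mu>' j)"
    using sum_class_function[OF _ m, of ?W "\<lambda>i. of_int (upper_rep m z i)" \<mu>]
      sum_class_function[OF _ m, of ?W' "\<lambda>i. of_int (upper_rep m z i)" \<mu>'] cls by simp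
  \<comment> \<open>A sum of nonnegative terms equals minus another such sum, so every term on
    either side is zero.\<close>
  then have eq: "(\<Sum>j\<in>?W. (?g j - of_int j) * \<mu> j) = - (\<Sum>j\<in>?W'. (of_int j - ?g j) * \<mu>' j)"
    using mom by (simp add: algebra_simps sum_subtractf)
  have nn1: "0 \<le> (?g j - of_int j) * \<mu> j" if "j \<in> ?W" for j using g nn that by simp
  have nn2: "0 \<le> (of_int j - ?g j) * \<mu>' j" if "j \<in> ?W'" for j using g' nn that by simp
  have "(\<Sum>j\<in>?W. (?g j - of_int j) * \<mu> j) = 0" "(\<Sum>j\<in>?W'. (of_int j - ?g j) * \<mu>' j) = 0"
    using eq sum_nonneg[of ?W "\<lambda>j. (?g j - of_int j) * \<mu> j", OF nn1]
      sum_nonneg[of ?W' "\<lambda>j. (of_int j - ?g j) * \<mu>' j", OF nn2] by linarith+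
  then have zero: "\<And>j. j \<in> ?W \<Longrightarrow> (?g j - of_int j) * \<mu> j = 0" "\<And>j. j \<in> ?W' \<Longrightarrow> (of_int j - ?g j) * \<mu>' j = 0"
    using sum_nonneg_eq_0_iff[of ?W "\<lambda>j. (?g j - of_int j) * \<mu> j", OF _ nn1]
      sum_nonneg_eq_0_iff[of ?W' "\<lambda>j. (of_int j - ?g j) * \<mu>' j", OF _ nn2] by blast+
  \<comment> \<open>At z the factor is m, which forces the weight there to vanish.\<close>
  have supp: "k \<in> {z + 1..z + int m}" if "k \<in> ?W" "\<mu> k \<noteq> 0" for k
    using zero(1)[OF that(1)] that upper_rep_window[OF m that(1)] m by (auto split: if_splits)
  \<comment> \<open>An index of nonzero weight equals its representative, hence is at most z + m; it
    exceeds z because z < z'.\<close>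
  have supp': "k \<in> {z + 1..z + int m}" if "k \<in> ?W'" "\<mu>' k \<noteq> 0" for k
  proof -
    have "upper_rep m z (residue m k) = k" using zero(2)[OF that(1)] that(2) by auto
    moreover have "upper_rep m z (residue m k) \<le> z + int m" 
      unfolding upper_rep_def using m pos_mod_bound[of "int m" "int (residue m k) - z - 1"] by linarith
    ultimately show ?thesis using that less by auto
  qed
  show ?thesis
  proof (cases "j \<in> {z + 1..z + int m}")
    case True
    show ?thesis
      using class_sum_upper_window[OF m True _ supp, of ?W] class_sum_upper_window[OF m True _ supp', of ?W']
        cls[of "residue m j"] residue_less[OF m] by simp
  next
    case False
    then show ?thesis using supp supp' by fastforce
  qed
qed

lemma window_weights_unique:
  fixes \<mu> \<mu>' :: "int \<Rightarrow> real"
  assumes m: "0 < m"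
    and nn: "\<And>j. j \<in> {z..z + int m} \<Longrightarrow> 0 \<le> \<mu> j" "\<And>j. j \<in> {z'..z' + int m} \<Longrightarrow> 0 \<le> \<mu>' j"
    and cls: "\<And>i. i < m \<Longrightarrow> class_sum m {z..z + int m} \<mu> i = class_sum m {z'..z' + int m} \<mu>' i"
    and mom: "(\<Sum>j\<in>{z..z + int m}. of_int j * \<mu> j) = (\<Sum>j\<in>{z'..z' + int m}. of_int j * \<mu>' j)"
  shows "(if j \<in> {z..z + int m} then \<mu> j else 0) = (if j \<in> {z'..z' + int m} then \<mu>' j else 0)"
proof (cases z z' rule: linorder_cases)
  case less
  then show ?thesis using window_weights_unique_less[OF m less nn cls mom] by blast
next
  case greater
  then show ?thesis using window_weights_unique_less[OF m greater nn(2,1) cls[symmetric] mom[symmetric]] by simp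
next
  case equal
  let ?W = "{z..z + int m}"
  \<comment> \<open>For equal windows the difference of the weights has zero class sums and zero
    moment. Moving z to z + m changes the moment by m times the difference at z, so that value is 0;
    the class sums then give the others one by one.\<close>
  let ?\<delta> = "\<lambda>j. \<mu> j - \<mu>' j"
  have cls0: "class_sum m ?W ?\<delta> i = 0" if "i < m" for i
    using cls[OF that] equal by (simp add: class_sum_def sum_subtractf)
  have "(\<Sum>j\<in>?W. real_of_int (upper_rep m z (residue m j)) * ?\<delta> j) = 0"
    using sum_class_function[OF _ m, of ?W "\<lambda>i. of_int (upper_rep m z i)" ?\<delta>] cls0 by simp
  moreover have "(\<Sum>j\<in>?W. of_int j * ?\<delta> j) = 0"
    using mom equal by (simp add: algebra_simps sum_subtractf)
  ultimately have "(\<Sum>j\<in>?W. (real_of_int (upper_rep m z (residue m j)) - of_int j) * ?\<delta> j) = 0"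
    by (simp add: left_diff_distrib sum_subtractf)
  moreover have "(\<Sum>j\<in>?W. (real_of_int (upper_rep m z (residue m j)) - of_int j) * ?\<delta> j) = (\<Sum>j\<in>?W. if j = z then real m * ?\<delta> j else 0)"
    using upper_rep_window[OF m] by (intro sum.cong) auto
  ultimately have z: "?\<delta> z = 0" using m by simp
  have "?\<delta> j = 0" if "j \<in> {z + 1..z + int m}"
  proof -
    have "k \<in> {z + 1..z + int m}" if "k \<in> ?W" "?\<delta> k \<noteq> 0" for k
      using that z by (cases "k = z") auto
    from class_sum_upper_window[OF m \<open>j \<in> _\<close> _ this, of ?W]
    show ?thesis using cls0[OF residue_less[OF m], of j] \<open>j \<in> _\<close> by simp
  qed
  then show ?thesis using z equal by (cases "j = z") auto
qed

section \<open>The lifted tessellation\<close>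

definition bary :: "(nat \<Rightarrow> real) set \<Rightarrow> ((nat \<Rightarrow> real) \<Rightarrow> real) \<Rightarrow> (nat \<Rightarrow> real) \<Rightarrow> bool" where
  "bary V u x \<longleftrightarrow> (\<forall>v\<in>V. 0 \<le> u v) \<and> sum u V = 1 \<and> x = (\<lambda>i. \<Sum>v\<in>V. u v * v i)"

lemma conv_pts_bary: "conv_pts V = {x. \<exists>u. bary V u x}"
  by (simp add: conv_pts_def bary_def)

text \<open>Taking both simplices equal gives affine independence, taking them different gives the
  face-to-face property.\<close>

definition unique_bary :: "(nat \<Rightarrow> real) set set \<Rightarrow> bool" where
  "unique_bary T \<longleftrightarrow> (\<forall>V\<in>T. \<forall>V'\<in>T. \<forall>u u' x. bary V u x \<longrightarrow> bary V' u' x \<longrightarrow>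
     (\<forall>v\<in>V. u v \<noteq> 0 \<longrightarrow> v \<in> V' \<and> u' v = u v))"

text \<open>The inverse of \<open>col\<close> on V is the labelling by which the next step lifts the
  simplex.\<close>

definition coloured :: "nat \<Rightarrow> ((nat \<Rightarrow> real) \<Rightarrow> nat) \<Rightarrow> (nat \<Rightarrow> real) set \<Rightarrow> bool" where
  "coloured n col V \<longleftrightarrow> V \<subseteq> Rd n \<and> bij_betw col V {..<Suc n}"

definition prism_vertex :: "nat \<Rightarrow> real \<Rightarrow> (nat \<Rightarrow> nat \<Rightarrow> real) \<Rightarrow> int \<Rightarrow> nat \<Rightarrow> real" where
  "prism_vertex n q A j = (A (residue (Suc n) j))(n := real_of_int j * q)"

definition prism_simplex :: "nat \<Rightarrow> real \<Rightarrow> (nat \<Rightarrow> nat \<Rightarrow> real) \<Rightarrow> int \<Rightarrow> (nat \<Rightarrow> real) set" where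
  "prism_simplex n q A z = prism_vertex n q A ` {z..z + int (Suc n)}"

definition prism_tess :: "nat \<Rightarrow> real \<Rightarrow> ((nat \<Rightarrow> real) \<Rightarrow> nat) \<Rightarrow> (nat \<Rightarrow> real) set set \<Rightarrow> (nat \<Rightarrow> real) set set" where
  "prism_tess n q col T = {prism_simplex n q (the_inv_into V col) z | V z. V \<in> T}"

text \<open>The last coordinate j q determines j, so weights on a lifted simplex may be indexed by
  j.\<close>

lemma inj_prism_vertex: "q \<noteq> 0 \<Longrightarrow> inj (prism_vertex n q A)"
  by (rule injI) (metis fun_upd_same mult_right_cancel of_int_eq_iff prism_vertex_def)

lemma coloured_finite: "coloured n col V \<Longrightarrow> finite V"
  by (auto simp: coloured_def bij_betw_finite)

lemma coloured_label:
  assumes "coloured n col V" "i < Suc n"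
  shows "the_inv_into V col i \<in> V" "col (the_inv_into V col i) = i"
  using assms unfolding coloured_def
  by (simp_all add: bij_betw_def the_inv_into_into f_the_inv_into_f)

lemma coloured_label_col:
  assumes "coloured n col V" "v \<in> V"
  shows "the_inv_into V col (col v) = v" "col v < Suc n"
  using assms unfolding coloured_def
  by (auto simp: bij_betw_def the_inv_into_f_f)

lemma coloured_sum:
  assumes "coloured n col V"
  shows "(\<Sum>i<Suc n. f i (the_inv_into V col i)) = (\<Sum>v\<in>V. f (col v) v :: 'a::comm_monoid_add)"
proof -
  have "(\<Sum>v\<in>V. f (col v) v) = (\<Sum>v\<in>V. f (col v) (the_inv_into V col (col v)))"
    using assms by (intro sum.cong) (auto simp: coloured_label_col)
  also have "\<dots> = (\<Sum>i<Suc n. f i (the_inv_into V col i))"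
    using assms by (intro sum.reindex_bij_betw) (simp add: coloured_def)
  finally show ?thesis ..
qed

lemma coloured_prod:
  assumes "coloured n col V"
  shows "(\<Prod>i<Suc n. f i (the_inv_into V col i)) = (\<Prod>v\<in>V. f (col v) v :: 'a::comm_monoid_mult)"
proof -
  have "(\<Prod>v\<in>V. f (col v) v) = (\<Prod>v\<in>V. f (col v) (the_inv_into V col (col v)))"
    using assms by (intro prod.cong) (auto simp: coloured_label_col)
  also have "\<dots> = (\<Prod>i<Suc n. f i (the_inv_into V col i))"
    using assms by (intro prod.reindex_bij_betw) (simp add: coloured_def)
  finally show ?thesis ..
qed

lemma sum_prism_simplex:
  assumes "q \<noteq> 0"
  shows "sum f (prism_simplex n q A z) = (\<Sum>j\<in>{z..z + int (Suc n)}. f (prism_vertex n q A j))"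
  unfolding prism_simplex_def
  by (subst sum.reindex) (auto intro: inj_on_subset[OF inj_prism_vertex[OF assms]])

lemma prod_prism_simplex:
  assumes "q \<noteq> 0"
  shows "prod f (prism_simplex n q A z) = (\<Prod>j\<in>{z..z + int (Suc n)}. f (prism_vertex n q A j))"
  unfolding prism_simplex_def
  by (subst prod.reindex) (auto intro: inj_on_subset[OF inj_prism_vertex[OF assms]])

text \<open>Erasing the last coordinate sends the lifted vertex with index j to the base vertex
  labelled j mod (n + 1), so the weights of a class accumulate there. The last coordinate of that
  lifted vertex is j q, whence the first moment.\<close>

lemma bary_prism_project:
  assumes col: "coloured n col V" and q: "q \<noteq> 0"
    and b: "bary (prism_simplex n q (the_inv_into V col) z) u x"
  defines "W \<equiv> {z..z + int (Suc n)}" and "\<mu> \<equiv> \<lambda>j. u (prism_vertex n q (the_inv_into V col) j)"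
  shows "\<And>j. j \<in> W \<Longrightarrow> 0 \<le> \<mu> j"
    and "bary V (\<lambda>v. class_sum (Suc n) W \<mu> (col v)) (x(n := 0))"
    and "x n = q * (\<Sum>j\<in>W. of_int j * \<mu> j)"
proof -
  let ?A = "the_inv_into V col"
  show nn: "0 \<le> \<mu> j" if "j \<in> W" for j
    using b that by (auto simp: bary_def prism_simplex_def \<mu>_def W_def)
  have x: "x i = (\<Sum>j\<in>W. \<mu> j * prism_vertex n q ?A j i)" for i
    using b q unfolding bary_def by (simp add: sum_prism_simplex W_def \<mu>_def)
  show "x n = q * (\<Sum>j\<in>W. of_int j * \<mu> j)"
    unfolding x by (simp add: prism_vertex_def sum_distrib_left mult_ac)
  have fin: "finite W" by (simp add: W_def)
  have "(\<Sum>v\<in>V. class_sum (Suc n) W \<mu> (col v)) = (\<Sum>i<Suc n. class_sum (Suc n) W \<mu> i)"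
    using coloured_sum[OF col, of "\<lambda>i v. class_sum (Suc n) W \<mu> i"] by simp
  also have "\<dots> = (\<Sum>j\<in>W. \<mu> j)"
    using sum_class_function[OF fin, of "Suc n" "\<lambda>_. 1" \<mu>] by simp
  also have "\<dots> = 1"
    using b q unfolding bary_def by (simp add: sum_prism_simplex W_def \<mu>_def)
  finally have s1: "(\<Sum>v\<in>V. class_sum (Suc n) W \<mu> (col v)) = 1" .
  have "(x(n := 0)) i = (\<Sum>v\<in>V. class_sum (Suc n) W \<mu> (col v) * v i)" for i
  proof (cases "i = n")
    case True
    have "v n = 0" if "v \<in> V" for v using col that by (auto simp: coloured_def Rd_def)
    then show ?thesis using True by (simp add: sum.neutral)
  next
    case False
    then have "x i = (\<Sum>j\<in>W. ?A (residue (Suc n) j) i * \<mu> j)"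
      unfolding x by (simp add: prism_vertex_def mult.commute)
    also have "\<dots> = (\<Sum>i'<Suc n. ?A i' i * class_sum (Suc n) W \<mu> i')"
      by (rule sum_class_function[OF fin]) simp
    also have "\<dots> = (\<Sum>v\<in>V. v i * class_sum (Suc n) W \<mu> (col v))"
      by (rule coloured_sum[OF col])
    finally show ?thesis using False by (simp add: mult.commute)
  qed
  moreover have "0 \<le> class_sum (Suc n) W \<mu> i" for i
    unfolding class_sum_def using nn by (auto intro: sum_nonneg)
  ultimately show "bary V (\<lambda>v. class_sum (Suc n) W \<mu> (col v)) (x(n := 0))"
    using s1 unfolding bary_def by blast
qed

text \<open>Uniqueness in the base equates the class sums, the last coordinate equates the moments,
  and \<open>window_weights_unique\<close> then equates the weights index by index. What remains is
  that an index of positive weight names the same point in both simplices.\<close>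

lemma unique_bary_prism_tess:
  assumes q: "q \<noteq> 0" and col: "\<And>V. V \<in> T \<Longrightarrow> coloured n col V" and uni: "unique_bary T"
  shows "unique_bary (prism_tess n q col T)"
  unfolding unique_bary_def
proof (intro ballI allI impI)
  fix X X' u u' x w
  assume X: "X \<in> prism_tess n q col T" "X' \<in> prism_tess n q col T"
    and b: "bary X u x" "bary X' u' x" and w: "w \<in> X" "u w \<noteq> 0"
  obtain V z where V: "V \<in> T" and Xd: "X = prism_simplex n q (the_inv_into V col) z"
    using X(1) by (auto simp: prism_tess_def)
  obtain V' z' where V': "V' \<in> T" and Xd': "X' = prism_simplex n q (the_inv_into V' col) z'"
    using X(2) by (auto simp: prism_tess_def)
  define m where "m = Suc n"
  let ?A = "the_inv_into V col" and ?A' = "the_inv_into V' col"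
  let ?W = "{z..z + int m}" and ?W' = "{z'..z' + int m}"
  define \<mu> where "\<mu> = (\<lambda>j. u (prism_vertex n q ?A j))"
  define \<mu>' where "\<mu>' = (\<lambda>j. u' (prism_vertex n q ?A' j))"
  note pr = bary_prism_project[OF col[OF V] q b(1)[unfolded Xd], folded m_def \<mu>_def]
  note pr' = bary_prism_project[OF col[OF V'] q b(2)[unfolded Xd'], folded m_def \<mu>'_def]
  \<comment> \<open>\<open>unique_bary\<close> speaks only of nonzero weights of the first simplex,
    so it is used in both directions.\<close>
  have c1: "v \<in> V' \<and> class_sum m ?W' \<mu>' (col v) = class_sum m ?W \<mu> (col v)"
    if "v \<in> V" "class_sum m ?W \<mu> (col v) \<noteq> 0" for v
    using uni V V' pr(2) pr'(2) that unfolding unique_bary_def by blast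
  have c2: "v \<in> V \<and> class_sum m ?W \<mu> (col v) = class_sum m ?W' \<mu>' (col v)"
    if "v \<in> V'" "class_sum m ?W' \<mu>' (col v) \<noteq> 0" for v
    using uni V V' pr(2) pr'(2) that unfolding unique_bary_def by blast
  have cls: "class_sum m ?W \<mu> i = class_sum m ?W' \<mu>' i" if "i < m" for i
    using c1[of "?A i"] c2[of "?A' i"] coloured_label[OF col[OF V]] coloured_label[OF col[OF V']] that
    unfolding m_def by metis
  have mom: "(\<Sum>j\<in>?W. of_int j * \<mu> j) = (\<Sum>j\<in>?W'. of_int j * \<mu>' j)"
    using pr(3) pr'(3) q by (simp add: \<mu>_def \<mu>'_def)
  have m: "0 < m" by (simp add: m_def)
  obtain j where j: "j \<in> ?W" "w = prism_vertex n q ?A j"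
    using w(1) by (auto simp: Xd prism_simplex_def m_def)
  then have \<mu>j: "\<mu> j = u w" by (simp add: \<mu>_def)
  have nn: "0 \<le> \<mu> k" if "k \<in> ?W" for k using pr(1) that by (simp add: \<mu>_def)
  have "(if j \<in> ?W then \<mu> j else 0) = (if j \<in> ?W' then \<mu>' j else 0)"
    using pr(1) pr'(1) by (intro window_weights_unique[OF m _ _ cls mom]) (auto simp: \<mu>_def \<mu>'_def)
  then have j': "j \<in> ?W'" "\<mu>' j = \<mu> j" using j w(2) \<mu>j by (auto split: if_splits)
  let ?r = "residue m j"
  have r: "?r < Suc n" using residue_less[OF m, of j] by (simp add: m_def)
  have "0 < \<mu> j" using nn[OF j(1)] w(2) \<mu>j by linarith
  then have "0 < class_sum m ?W \<mu> ?r"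
    unfolding class_sum_def using nn j(1) by (intro sum_pos2[of _ j]) (auto intro: finite_subset[of _ ?W])
  then have "?A ?r \<in> V'"
    \<comment> \<open>A positive class sum puts the base vertex into both simplices; as
      \<open>col\<close> depends on the point only, it has the same label in both.\<close>
    using c1[of "?A ?r"] coloured_label[OF col[OF V] r] by auto
  then have "?A' ?r = ?A ?r"
    using coloured_label[OF col[OF V] r] coloured_label_col(1)[OF col[OF V'], of "?A ?r"] by simp
  then have "prism_vertex n q ?A' j = w"
    using j by (simp add: prism_vertex_def m_def)
  then show "w \<in> X' \<and> u' w = u w"
    using j' \<mu>j unfolding Xd' prism_simplex_def \<mu>'_def m_def by auto
qed

section \<open>Layers of a prism and the covering property\<close>

text \<open>If \<open>l i\<close> are the barycentric coordinates of \<open>x\<close>, the simplex with index \<open>z\<close> is the part of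
  the prism over which \<open>t / q\<close> lies between the heights \<open>z\<close> and \<open>z + 1\<close> at \<open>x\<close>.\<close>

definition prism_height :: "nat \<Rightarrow> (nat \<Rightarrow> real) \<Rightarrow> int \<Rightarrow> real" where
  "prism_height m l z = (\<Sum>j\<in>{z..<z + int m}. of_int j * l (residue m j))"

text \<open>Inner indices inherit the coordinate of their class. The end points divide the
  coordinate of their common class, and the share of z + m is the one that makes the first moment
  equal to \<tau>.\<close>

definition prism_weight :: "nat \<Rightarrow> (nat \<Rightarrow> real) \<Rightarrow> int \<Rightarrow> real \<Rightarrow> int \<Rightarrow> real" where
  "prism_weight m l z \<tau> j =
     (if j = z then l (residue m z) - (\<tau> - prism_height m l z) / real m
      else if j = z + int m then (\<tau> - prism_height m l z) / real m
      else l (residue m j))"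

lemma sum_window_lessThan:
  assumes "0 < m"
  shows "(\<Sum>j\<in>{z..<z + int m}. f j) = f z + (\<Sum>j\<in>{z + 1..<z + int m}. f j :: 'a::comm_monoid_add)"
proof -
  have "{z..<z + int m} = insert z {z + 1..<z + int m}" using assms by auto
  then show ?thesis by simp
qed

text \<open>Advancing z replaces the index z by z + m, which is in the same class; hence the top of
  each layer is the bottom of the next.\<close>

lemma prism_height_Suc:
  assumes "0 < m"
  shows "prism_height m l (z + 1) = prism_height m l z + real m * l (residue m z)"
proof -
  have "{z + 1..<z + 1 + int m} = insert (z + int m) {z + 1..<z + int m}" using assms by auto
  then show ?thesis
    using assms by (simp add: prism_height_def sum_window_lessThan algebra_simps)
qed

lemma prism_weight_class_sum:
  assumes m: "0 < m"
  shows "(\<Sum>j\<in>{z..z + int m}. prism_weight m l z \<tau> j * f (residue m j)) = (\<Sum>i<m. l i * f i)"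
proof -
  have "(\<Sum>j\<in>{z + 1..<z + int m}. prism_weight m l z \<tau> j * f (residue m j)) =
      (\<Sum>j\<in>{z + 1..<z + int m}. l (residue m j) * f (residue m j))"
    by (intro sum.cong) (auto simp: prism_weight_def)
  then show ?thesis
    unfolding sum_window[OF m] sum_residue[OF m, of _ z] using m
    by (simp add: prism_weight_def algebra_simps)
qed

lemma prism_weight_moment:
  assumes m: "0 < m"
  shows "(\<Sum>j\<in>{z..z + int m}. prism_weight m l z \<tau> j * of_int j) = \<tau>"
proof -
  have "(\<Sum>j\<in>{z + 1..<z + int m}. prism_weight m l z \<tau> j * of_int j) =
      (\<Sum>j\<in>{z + 1..<z + int m}. of_int j * l (residue m j))"
    by (intro sum.cong) (auto simp: prism_weight_def)
  note 1 = this
  define s where "s = (\<tau> - prism_height m l z) / real m"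
  moreover have "real m * s = \<tau> - prism_height m l z"
    using m by (simp add: s_def)
  then have 2: "real m * s = \<tau> - of_int z * l (residue m z) - (\<Sum>j\<in>{z + 1..<z + int m}. of_int j * l (residue m j))"
    using m by (simp add: prism_height_def sum_window_lessThan)
  have 3: "prism_weight m l z \<tau> z = l (residue m z) - s" "prism_weight m l z \<tau> (z + int m) = s"
    using m by (simp_all add: prism_weight_def s_def)
  show ?thesis
    unfolding sum_window[OF m] 1 3 using 2 by (simp add: algebra_simps)
qed

text \<open>The end points ask for a share between 0 and the coordinate of their class, which makes
  that coordinate nonnegative; every other class occurs exactly once among the inner
  indices.\<close>

lemma prism_weight_nonneg_iff:
  assumes m: "0 < m"
  shows "(\<forall>j\<in>{z..z + int m}. 0 \<le> prism_weight m l z \<tau> j) \<longleftrightarrow>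
    (\<forall>i<m. 0 \<le> l i) \<and> 0 \<le> (\<tau> - prism_height m l z) / real m \<and>
    (\<tau> - prism_height m l z) / real m \<le> l (residue m z)" (is "?L \<longleftrightarrow> ?R")
proof -
  let ?s = "(\<tau> - prism_height m l z) / real m"
  have "(\<forall>j\<in>{z + 1..<z + int m}. 0 \<le> prism_weight m l z \<tau> j) \<longleftrightarrow>
      (\<forall>j\<in>{z + 1..<z + int m}. 0 \<le> l (residue m j))"
    by (intro ball_cong) (auto simp: prism_weight_def)
  moreover have "?L \<longleftrightarrow> 0 \<le> prism_weight m l z \<tau> z \<and> 0 \<le> prism_weight m l z \<tau> (z + int m) \<and>
      (\<forall>j\<in>{z + 1..<z + int m}. 0 \<le> prism_weight m l z \<tau> j)"
    by (simp only: window_eq[OF m] ball_simps)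
  moreover have "prism_weight m l z \<tau> z = l (residue m z) - ?s" "prism_weight m l z \<tau> (z + int m) = ?s"
    using m by (simp_all add: prism_weight_def)
  ultimately show ?thesis
    unfolding all_residue[OF m, of _ z] by auto
qed

text \<open>This is a purely affine identity for coordinates of any sign. It serves the covering as
  well as the coordinate functions on the whole space in the volume computation.\<close>

lemma prism_weight_reconstruct:
  fixes z :: int
  assumes col: "coloured n col V" and q: "q \<noteq> 0"
    and one: "sum \<beta> V = 1" and co: "\<And>i. i < n \<Longrightarrow> (\<Sum>v\<in>V. \<beta> v * v i) = y i"
  defines "A \<equiv> the_inv_into V col"
  defines "w \<equiv> prism_weight (Suc n) (\<lambda>i. \<beta> (A i)) z (y n / q)"
  shows "(\<Sum>j\<in>{z..z + int (Suc n)}. w j) = 1"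
    and "i < Suc n \<Longrightarrow> (\<Sum>j\<in>{z..z + int (Suc n)}. w j * prism_vertex n q A j i) = y i"
proof -
  have "(\<Sum>i<Suc n. \<beta> (A i)) = 1"
    unfolding A_def using coloured_sum[OF col, of "\<lambda>_. \<beta>"] one by simp
  then show "(\<Sum>j\<in>{z..z + int (Suc n)}. w j) = 1"
    using prism_weight_class_sum[of "Suc n" "\<lambda>i. \<beta> (A i)" z "y n / q" "\<lambda>_. 1"] by (simp add: w_def)
  assume i: "i < Suc n"
  show "(\<Sum>j\<in>{z..z + int (Suc n)}. w j * prism_vertex n q A j i) = y i"
  proof (cases "i = n")
    case True
    have "(\<Sum>j\<in>{z..z + int (Suc n)}. w j * prism_vertex n q A j n) =
        q * (\<Sum>j\<in>{z..z + int (Suc n)}. w j * of_int j)"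
      by (simp add: prism_vertex_def sum_distrib_left mult_ac)
    also have "\<dots> = y n" unfolding w_def using q by (subst prism_weight_moment) auto
    finally show ?thesis using True by simp
  next
    case False
    have "(\<Sum>j\<in>{z..z + int (Suc n)}. w j * prism_vertex n q A j i) =
        (\<Sum>j\<in>{z..z + int (Suc n)}. w j * A (residue (Suc n) j) i)"
      using False by (simp add: prism_vertex_def)
    also have "\<dots> = (\<Sum>k<Suc n. \<beta> (A k) * A k i)"
      unfolding w_def using prism_weight_class_sum[of "Suc n" _ _ _ "\<lambda>k. A k i"] by simp
    also have "\<dots> = (\<Sum>v\<in>V. \<beta> v * v i)"
      unfolding A_def by (rule coloured_sum[OF col])
    also have "\<dots> = y i" using co i False by simp
    finally show ?thesis .
  qed
qed

text \<open>The height is a weighted mean of the integers z, ..., z + m - 1.\<close>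

lemma prism_height_bounds:
  assumes m: "0 < m" and nn: "\<And>i. i < m \<Longrightarrow> 0 \<le> l i" and one: "(\<Sum>i<m. l i) = 1"
  shows "of_int z \<le> prism_height m l z" "prism_height m l z \<le> of_int z + real m"
proof -
  have one': "(\<Sum>j\<in>{z..<z + int m}. l (residue m j)) = 1"
    using one sum.reindex_bij_betw[OF bij_betw_residue[OF m, of z], of l] by simp
  have "of_int z = (\<Sum>j\<in>{z..<z + int m}. of_int z * l (residue m j))"
    by (simp add: one' flip: sum_distrib_left)
  also have "\<dots> \<le> prism_height m l z"
    unfolding prism_height_def using nn residue_less[OF m] by (intro sum_mono mult_right_mono) auto
  finally show "of_int z \<le> prism_height m l z" .
  have "prism_height m l z \<le> (\<Sum>j\<in>{z..<z + int m}. (of_int z + real m) * l (residue m j))"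
    unfolding prism_height_def using nn residue_less[OF m] by (intro sum_mono mult_right_mono) auto
  also have "\<dots> = of_int z + real m"
    by (simp add: one' flip: sum_distrib_left)
  finally show "prism_height m l z \<le> of_int z + real m" .
qed

lemma prism_level_exists:
  assumes m: "0 < m" and nn: "\<And>i. i < m \<Longrightarrow> 0 \<le> l i" and one: "(\<Sum>i<m. l i) = 1"
  obtains z where "prism_height m l z \<le> \<tau>" "\<tau> \<le> prism_height m l (z + 1)"
proof -
  \<comment> \<open>Here the upper bound z + m on the height is the floor of \<tau>, so the height
    is at most \<tau>.\<close>
  let ?z0 = "\<lfloor>\<tau>\<rfloor> - int m"
  have "\<exists>z. prism_height m l z \<le> \<tau> \<and> \<not> prism_height m l (z + 1) \<le> \<tau>"
  proof (rule ccontr)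
    assume "\<not> ?thesis"
    then have step: "prism_height m l z \<le> \<tau> \<Longrightarrow> prism_height m l (z + 1) \<le> \<tau>" for z by blast
    have "prism_height m l z \<le> \<tau>" if "?z0 \<le> z" for z
      using that
    proof (induction z rule: int_ge_induct)
      case base
      show ?case using prism_height_bounds(2)[OF assms, of ?z0] by simp linarith
    next
      case (step i)
      then show ?case using \<open>\<And>z. prism_height m l z \<le> \<tau> \<Longrightarrow> _\<close> by blast
    qed
    \<comment> \<open>Without a crossing the heights would never exceed \<tau>, but this one is at
      least floor \<tau> + 1.\<close>
    from this[of "\<lfloor>\<tau>\<rfloor> + 1"] prism_height_bounds(1)[OF assms, of "\<lfloor>\<tau>\<rfloor> + 1"]
    show False by simp linarith
  qed
  then show ?thesis using that by (metis linear)
qed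

lemma prism_tess_cover:
  assumes q: "q \<noteq> 0" and col: "\<And>V. V \<in> T \<Longrightarrow> coloured n col V"
    and cover: "Rd n \<subseteq> (\<Union>V\<in>T. conv_pts V)"
  shows "Rd (Suc n) \<subseteq> (\<Union>V\<in>prism_tess n q col T. conv_pts V)"
proof
  fix x assume x: "x \<in> Rd (Suc n)"
  then have "x(n := 0) \<in> Rd n" by (auto simp: Rd_def)
  then obtain V u where V: "V \<in> T" and b: "bary V u (x(n := 0))"
    using cover by (auto simp: conv_pts_bary)
  let ?A = "the_inv_into V col"
  let ?l = "\<lambda>i. u (?A i)"
  have nn: "0 \<le> ?l i" if "i < Suc n" for i
    using b coloured_label(1)[OF col[OF V] that] by (simp add: bary_def)
  have one: "(\<Sum>i<Suc n. ?l i) = 1"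
    using coloured_sum[OF col[OF V], of "\<lambda>_. u"] b by (simp add: bary_def)
  \<comment> \<open>By \<open>prism_height_Suc\<close>, these inequalities say that the share of z +
    m lies between 0 and the coordinate of the class of z.\<close>
  obtain z where z: "prism_height (Suc n) ?l z \<le> x n / q" "x n / q \<le> prism_height (Suc n) ?l (z + 1)"
    using prism_level_exists[OF _ nn one, where \<tau> = "x n / q"] by auto
  define w where "w = prism_weight (Suc n) ?l z (x n / q)"
  let ?B = "prism_vertex n q ?A"
  have "0 \<le> w j" if "j \<in> {z..z + int (Suc n)}" for j
  proof -
    have "\<forall>j\<in>{z..z + int (Suc n)}. 0 \<le> w j"
      unfolding w_def using z nn prism_height_Suc[of "Suc n" ?l z]
      by (subst prism_weight_nonneg_iff) (auto simp: field_simps)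
    then show ?thesis using that by blast
  qed
  moreover
  have co: "(\<Sum>v\<in>V. u v * v i) = x i" if "i < n" for i
  proof -
    have "x(n := 0) = (\<lambda>i. \<Sum>v\<in>V. u v * v i)" using b by (simp add: bary_def)
    from fun_cong[OF this, of i] show ?thesis using that by simp
  qed
  have sum1: "sum u V = 1" using b by (simp add: bary_def)
  note rec = prism_weight_reconstruct[OF col[OF V] q sum1 co, where z = z, folded w_def]
  have inv: "the_inv ?B (?B j) = j" for j
    by (rule the_inv_f_f[OF inj_prism_vertex[OF q]])
  have "x i = (\<Sum>j\<in>{z..z + int (Suc n)}. w j * ?B j i)" for i
  proof (cases "i < Suc n")
    case True
    then show ?thesis using rec(2)[of i] by simp
  next
    case False
    have "?B j i = 0" for j
      using False col[OF V] coloured_label(1)[OF col[OF V] residue_less[of "Suc n" j]]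
      by (auto simp: prism_vertex_def coloured_def Rd_def)
    then show ?thesis using False x by (simp add: Rd_def)
  qed
  ultimately have "bary (prism_simplex n q ?A z) (\<lambda>v. w (the_inv ?B v)) x"
    unfolding bary_def sum_prism_simplex[OF q] inv using rec(1)
    by (auto simp: prism_simplex_def inv)
  then show "x \<in> (\<Union>V\<in>prism_tess n q col T. conv_pts V)"
    using V by (auto simp: conv_pts_bary prism_tess_def)
qed

text \<open>Rounding x n / q recovers j, and the n + 2 consecutive indices of a lifted simplex are a
  complete residue system modulo n + 2.\<close>

lemma coloured_prism_simplex:
  assumes q: "q \<noteq> 0" and col: "coloured n col V"
  shows "coloured (Suc n) (\<lambda>x. residue (Suc (Suc n)) (round (x n / q))) (prism_simplex n q (the_inv_into V col) z)"
proof -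
  let ?B = "prism_vertex n q (the_inv_into V col)"
  have "?B j \<in> Rd (Suc n)" for j
    using col coloured_label(1)[OF col residue_less[of "Suc n" j]]
    by (auto simp: prism_vertex_def coloured_def Rd_def)
  moreover have "round (?B j n / q) = j" for j using q by (simp add: prism_vertex_def)
  then have "bij_betw ((\<lambda>x. residue (Suc (Suc n)) (round (x n / q))) \<circ> ?B) {z..z + int (Suc n)} {..<Suc (Suc n)}"
  proof -
    have "{z..z + int (Suc n)} = {z..<z + int (Suc (Suc n))}" by auto
    then show ?thesis using bij_betw_residue[of "Suc (Suc n)" z] \<open>\<And>j. round _ = j\<close>
      by (simp add: o_def)
  qed
  then have "bij_betw (\<lambda>x. residue (Suc (Suc n)) (round (x n / q))) (?B ` {z..z + int (Suc n)}) {..<Suc (Suc n)}"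
    by (subst bij_betw_comp_iff[of ?B _ "?B ` {z..z + int (Suc n)}"])
      (auto simp: bij_betw_def intro: inj_on_subset[OF inj_prism_vertex[OF q]])
  ultimately show ?thesis by (auto simp: coloured_def prism_simplex_def)
qed

section \<open>Moments of barycentric coordinates\<close>

text \<open>This is the Beta integral scaled to {0..c}. Integration by parts, with vanishing
  boundary terms, reduces the exponents (b, a + 1) to (b + 1, a), so b must be arbitrary in the
  induction.\<close>

lemma has_integral_power_mult_power:
  fixes c :: real
  assumes c: "0 \<le> c"
  shows "((\<lambda>s. s ^ b * (c - s) ^ a) has_integral c ^ (a + b + 1) * fact a * fact b / fact (a + b + 1)) {0..c}"
proof (induction a arbitrary: b)
  case 0
  have "((\<lambda>s. s ^ Suc b / real (Suc b)) has_real_derivative s ^ b) (at s within {0..c})" for s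
    using DERIV_cdivide[OF DERIV_pow[of "Suc b" s "{0..c}"], of "real (Suc b)"] by simp
  then have "((\<lambda>s. s ^ b) has_integral c ^ Suc b / real (Suc b) - 0 ^ Suc b / real (Suc b)) {0..c}"
    using c by (intro fundamental_theorem_of_calculus)
      (simp_all flip: has_real_derivative_iff_has_vector_derivative)
  moreover have "c ^ (0 + b + 1) * fact 0 * fact b / fact (0 + b + 1) = c ^ Suc b / real (Suc b) - 0 ^ Suc b / real (Suc b)"
    by (simp add: divide_simps)
  ultimately show ?case by simp
next
  case (Suc a)
  have "((\<lambda>s. s ^ Suc b * (c - s) ^ Suc a) has_real_derivative
      real (Suc b) * (s ^ b * (c - s) ^ Suc a) - real (Suc a) * (s ^ Suc b * (c - s) ^ a)) (at s within {0..c})" for s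
  proof -
    have "((\<lambda>s. c - s) has_real_derivative -1) (at s within {0..c})"
      by (auto intro!: derivative_eq_intros)
    from DERIV_mult[OF DERIV_power_Suc[OF DERIV_ident, of b s "{0..c}"] DERIV_power_Suc[OF this, of a]]
    show ?thesis by (rule DERIV_cong) (simp add: algebra_simps)
  qed
  then have "((\<lambda>s. real (Suc b) * (s ^ b * (c - s) ^ Suc a) - real (Suc a) * (s ^ Suc b * (c - s) ^ a)) has_integral
      c ^ Suc b * (c - c) ^ Suc a - 0 ^ Suc b * (c - 0) ^ Suc a) {0..c}"
    using c by (intro fundamental_theorem_of_calculus)
      (simp_all flip: has_real_derivative_iff_has_vector_derivative)
  from has_integral_add[OF this has_integral_mult_right[OF Suc.IH[of "Suc b"], of "real (Suc a)"]]
  have "((\<lambda>s. real (Suc b) * (s ^ b * (c - s) ^ Suc a)) has_integral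
      real (Suc a) * (c ^ (a + Suc b + 1) * fact a * fact (Suc b) / fact (a + Suc b + 1))) {0..c}"
    by simp
  from has_integral_mult_right[OF this, of "1 / real (Suc b)"]
  have "((\<lambda>s. s ^ b * (c - s) ^ Suc a) has_integral
      1 / real (Suc b) * (real (Suc a) * (c ^ (a + Suc b + 1) * fact a * fact (Suc b) / fact (a + Suc b + 1)))) {0..c}"
    by (simp del: fact_Suc)
  moreover have "1 / real (Suc b) * (real (Suc a) * (C * fact a * fact (Suc b) / D)) = C * fact (Suc a) * fact b / D" for C D :: real
    by (simp del: of_nat_Suc)
  ultimately show ?case by (simp only: add_Suc add_Suc_right)
qed

text \<open>Along a vertical line only the two end weights vary, as c - s and s with s affine in t.
  Their Beta integral yields the power a + b + 1 of c, so a monomial in the lifted weights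
  integrates to a monomial in the base coordinates with exponents e'.\<close>

lemma nn_integral_prism_weight:
  fixes q :: real
  assumes m: "0 < m" and q: "q \<noteq> 0"
    and e'0: "e' (residue m z) = e z + e (z + int m) + 1"
    and e': "\<And>j. j \<in> {z + 1..<z + int m} \<Longrightarrow> e' (residue m j) = e j"
  shows "(\<integral>\<^sup>+t. ennreal (if \<forall>j\<in>{z..z + int m}. 0 \<le> prism_weight m l z (t / q) j
            then \<Prod>j\<in>{z..z + int m}. prism_weight m l z (t / q) j ^ e j else 0) \<partial>lborel) =
    ennreal (\<bar>q\<bar> * real m * (fact (e z) * fact (e (z + int m)) / fact (e z + e (z + int m) + 1))) *
    ennreal (if \<forall>i<m. 0 \<le> l i then \<Prod>i<m. l i ^ e' i else 0)" (is "(\<integral>\<^sup>+t. ?f t \<partial>lborel) = ?R")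
proof -
  define h c P where "h = prism_height m l z" and "c = l (residue m z)"
    and "P = (\<Prod>j\<in>{z + 1..<z + int m}. l (residue m j) ^ e j)"
  define a b where "a = e z" and "b = e (z + int m)"
  define Q where "Q \<longleftrightarrow> (\<forall>i<m. 0 \<le> l i)"
  let ?g = "\<lambda>s. ennreal (if Q \<and> 0 \<le> s \<and> s \<le> c then P * (s ^ b * (c - s) ^ a) else 0)"
  have f: "?f t = ?g ((t / q - h) / real m)" for t
  proof -
    have "(\<Prod>j\<in>{z + 1..<z + int m}. prism_weight m l z (t / q) j ^ e j) = P"
      unfolding P_def by (intro prod.cong) (auto simp: prism_weight_def)
    then have "(\<Prod>j\<in>{z..z + int m}. prism_weight m l z (t / q) j ^ e j) =
        P * (((t / q - h) / real m) ^ b * (c - (t / q - h) / real m) ^ a)"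
      unfolding prod_window[OF m] using m by (simp add: prism_weight_def h_def c_def a_def b_def)
    then show ?thesis
      unfolding prism_weight_nonneg_iff[OF m] by (simp only: h_def c_def Q_def)
  qed
  have e'P: "(\<Prod>i<m. l i ^ e' i) = c ^ (a + b + 1) * P"
    unfolding prod_residue[OF m, of _ z] using e'0 e' by (simp add: P_def c_def a_def b_def)
  have "(\<integral>\<^sup>+t. ?f t \<partial>lborel) = ennreal \<bar>q * real m\<bar> * (\<integral>\<^sup>+s. ?g ((((q * h) + (q * real m) * s) / q - h) / real m) \<partial>lborel)"
    unfolding f using q m by (intro nn_integral_real_affine) auto
  \<comment> \<open>With t = q h + q m s, the variable s is the share of the index z + m.\<close>
  also have "(\<lambda>s. (((q * h) + (q * real m) * s) / q - h) / real m) = (\<lambda>s. s)"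
    using q m by (auto simp: field_simps)
  then have "(\<lambda>s. ?g ((((q * h) + (q * real m) * s) / q - h) / real m)) = ?g"
    by (metis (no_types, lifting))
  also have "(\<integral>\<^sup>+s. ?g s \<partial>lborel) =
      ennreal (fact a * fact b / fact (a + b + 1)) * ennreal (if Q then c ^ (a + b + 1) * P else 0)"
  proof (cases Q)
    case True
    have c: "0 \<le> c" using True residue_less[OF m] by (simp add: c_def Q_def)
    have P: "0 \<le> P" unfolding P_def using True residue_less[OF m] by (intro prod_nonneg) (auto simp: Q_def)
    have "(\<integral>\<^sup>+s. ?g s \<partial>lborel) = (\<integral>\<^sup>+s. ennreal (P * (s ^ b * (c - s) ^ a)) * indicator {0..c} s \<partial>lborel)"
      using True by (intro nn_integral_cong) (auto simp: indicator_def)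
    also have "\<dots> = ennreal (P * (c ^ (a + b + 1) * fact a * fact b / fact (a + b + 1)))"
      using P by (intro nn_integral_has_integral_lebesgue' has_integral_mult_right has_integral_power_mult_power c) auto
    also have "\<dots> = ennreal (fact a * fact b / fact (a + b + 1)) * ennreal (c ^ (a + b + 1) * P)"
      using c P by (subst ennreal_mult[symmetric]) (auto simp: mult_ac)
    finally show ?thesis using True by simp
  qed simp
  finally have "(\<integral>\<^sup>+t. ?f t \<partial>lborel) = ennreal \<bar>q * real m\<bar> * (ennreal (fact a * fact b / fact (a + b + 1)) *
      ennreal (if Q then c ^ (a + b + 1) * P else 0))" .
  moreover have "ennreal \<bar>q * real m\<bar> * (ennreal C * R) = ennreal (\<bar>q\<bar> * real m * C) * R" if "0 \<le> C" for C R
    using that by (simp add: ennreal_mult abs_mult mult.assoc)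
  ultimately show ?thesis
    unfolding e'P Q_def[symmetric] a_def[symmetric] b_def[symmetric] by simp
qed

text \<open>The volume of a prism simplex is the integral of one barycentric coordinate over the base, so the
  volume alone does not carry an induction. The Dirichlet formula for all monomials does, and
  being symmetric in the vertices it needs no affine change of variables.\<close>

definition simplex_moments :: "nat \<Rightarrow> (nat \<Rightarrow> real) set \<Rightarrow> real \<Rightarrow> bool" where
  "simplex_moments n V M \<longleftrightarrow> (\<exists>\<beta> :: (nat \<Rightarrow> real) \<Rightarrow> (nat \<Rightarrow> real) \<Rightarrow> real.
     (\<forall>v\<in>V. \<beta> v \<in> borel_measurable (Pi\<^sub>M {..<n} (\<lambda>_. lborel))) \<and>
     (\<forall>y\<in>space (Pi\<^sub>M {..<n} (\<lambda>_. lborel :: real measure)).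
        (\<Sum>v\<in>V. \<beta> v y) = 1 \<and> (\<forall>i<n. (\<Sum>v\<in>V. \<beta> v y * v i) = y i)) \<and>
     (\<forall>a. (\<integral>\<^sup>+y. ennreal (if \<forall>v\<in>V. 0 \<le> \<beta> v y then \<Prod>v\<in>V. \<beta> v y ^ a v else 0) \<partial>Pi\<^sub>M {..<n} (\<lambda>_. lborel)) =
        ennreal (M * fact n * (\<Prod>v\<in>V. fact (a v)) / fact (n + (\<Sum>v\<in>V. a v)))))"

text \<open>The empty product measure is a unit mass at one point, and the formula reads 1 = a! /
  a!.\<close>

lemma simplex_moments_origin: "simplex_moments 0 {\<lambda>_. 0} 1"
  unfolding simplex_moments_def
  by (intro exI[of _ "\<lambda>_ _. 1"]) (auto simp: PiM_empty emeasure_count_space)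

text \<open>Fubini in the last coordinate and \<open>nn_integral_prism_weight\<close> reduce each
  moment of the lifted simplex to a single moment of the base.\<close>

lemma simplex_moments_prism:
  assumes q: "q \<noteq> 0" and col: "coloured n col V" and M: "0 \<le> M" and sm: "simplex_moments n V M"
  shows "simplex_moments (Suc n) (prism_simplex n q (the_inv_into V col) z) (M * \<bar>q\<bar>)"
proof -
  let ?P = "\<lambda>n. Pi\<^sub>M {..<n} (\<lambda>_. lborel :: real measure)"
  interpret product_sigma_finite "\<lambda>_::nat. lborel :: real measure"
    by (simp add: product_sigma_finite_def lborel.sigma_finite_measure_axioms)
  obtain \<beta> where bm: "\<And>v. v \<in> V \<Longrightarrow> \<beta> v \<in> borel_measurable (?P n)"
    and one: "\<And>y. y \<in> space (?P n) \<Longrightarrow> (\<Sum>v\<in>V. \<beta> v y) = 1"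
    and co: "\<And>y i. y \<in> space (?P n) \<Longrightarrow> i < n \<Longrightarrow> (\<Sum>v\<in>V. \<beta> v y * v i) = y i"
    and mo: "\<And>a. (\<integral>\<^sup>+y. ennreal (if \<forall>v\<in>V. 0 \<le> \<beta> v y then \<Prod>v\<in>V. \<beta> v y ^ a v else 0) \<partial>?P n) =
        ennreal (M * fact n * (\<Prod>v\<in>V. fact (a v)) / fact (n + (\<Sum>v\<in>V. a v)))"
    using sm unfolding simplex_moments_def by blast
  define m where "m = Suc n"
  have m: "0 < m" by (simp add: m_def)
  define A where "A = the_inv_into V col"
  define B where "B = prism_vertex n q A"
  \<comment> \<open>The base coordinate functions live on functions that are undefined from n on,
    hence the restriction.\<close>
  define w where "w = (\<lambda>y. prism_weight m (\<lambda>i. \<beta> (A i) (restrict y {..<n})) z (y n / q))"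
  define \<beta>' where "\<beta>' = (\<lambda>v y. w y (the_inv B v))"
  let ?W = "{z..z + int m}" and ?X = "prism_simplex n q A z"
  have inv: "the_inv B (B j) = j" for j
    unfolding B_def by (rule the_inv_f_f[OF inj_prism_vertex[OF q]])
  have \<beta>'B: "\<beta>' (B j) = (\<lambda>y. w y j)" for j by (simp add: \<beta>'_def inv)
  have XB: "?X = B ` ?W" by (simp add: prism_simplex_def B_def m_def)
  have sumX: "(\<Sum>v\<in>?X. f v) = (\<Sum>j\<in>?W. f (B j))" for f :: "_ \<Rightarrow> real"
    using sum_prism_simplex[OF q] by (simp add: B_def m_def)
  have sumXn: "(\<Sum>v\<in>?X. f v) = (\<Sum>j\<in>?W. f (B j))" for f :: "_ \<Rightarrow> nat"
    using sum_prism_simplex[OF q] by (simp add: B_def m_def)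
  have prodX: "(\<Prod>v\<in>?X. f v) = (\<Prod>j\<in>?W. f (B j))" for f :: "_ \<Rightarrow> real"
    using prod_prism_simplex[OF q] by (simp add: B_def m_def)
  have AV: "A i \<in> V" if "i < m" for i
    using coloured_label(1)[OF col] that by (simp add: A_def m_def)
  have [measurable]: "(\<lambda>y. \<beta> (A i) (restrict y {..<n})) \<in> borel_measurable (?P (Suc n))" if "i < m" for i
    using bm[OF AV[OF that]] by (rule measurable_compose[rotated]) (rule measurable_restrict_subset, auto)
  have yn[measurable]: "(\<lambda>y. y n) \<in> borel_measurable (?P (Suc n))"
    using measurable_component_singleton[of n "{..<Suc n}" "\<lambda>_. lborel :: real measure"] by simp
  have hm[measurable]: "(\<lambda>y. prism_height m (\<lambda>i. \<beta> (A i) (restrict y {..<n})) z) \<in> borel_measurable (?P (Suc n))"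
    unfolding prism_height_def using residue_less[OF m] by measurable
  have wm[measurable]: "(\<lambda>y. w y j) \<in> borel_measurable (?P (Suc n))" for j
    unfolding w_def prism_weight_def using residue_less[OF m] by measurable
  have rs: "restrict y {..<n} \<in> space (?P n)" if "y \<in> space (?P (Suc n))" for y
    using that by (auto simp: space_PiM)
  have rec: "(\<Sum>j\<in>?W. w y j) = 1" "i < Suc n \<Longrightarrow> (\<Sum>j\<in>?W. w y j * B j i) = y i"
    if y: "y \<in> space (?P (Suc n))" for y i
  proof -
    have co': "(\<Sum>v\<in>V. \<beta> v (restrict y {..<n}) * v i) = y i" if "i < n" for i
      using co[OF rs[OF y] that] that by simp
    note r = prism_weight_reconstruct[OF col q one[OF rs[OF y]] co', where z = z, folded A_def m_def]
    show "(\<Sum>j\<in>?W. w y j) = 1" using r(1) by (simp add: w_def)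
    show "(\<Sum>j\<in>?W. w y j * B j i) = y i" if "i < Suc n"
      using r(2)[of i] that unfolding w_def B_def m_def by blast
  qed
  have mom: "(\<integral>\<^sup>+y. ennreal (if \<forall>v\<in>?X. 0 \<le> \<beta>' v y then \<Prod>v\<in>?X. \<beta>' v y ^ a v else 0) \<partial>?P (Suc n)) =
      ennreal (M * \<bar>q\<bar> * fact (Suc n) * (\<Prod>v\<in>?X. fact (a v)) / fact (Suc n + (\<Sum>v\<in>?X. a v)))"
    (is "?L = _") for a
  proof -
    define e where "e = (\<lambda>j. a (B j))"
    \<comment> \<open>The class of the end points receives both exponents and the 1 from the Beta
      integral; any other class keeps the exponent of its only inner index.\<close>
    define e' where "e' = (\<lambda>i. if i = residue m z then e z + e (z + int m) + 1 else e (upper_rep m z i))"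
    let ?c = "fact (e z) * fact (e (z + int m)) / fact (e z + e (z + int m) + 1) :: real"
    have e'0: "e' (residue m z) = e z + e (z + int m) + 1" by (simp add: e'_def)
    have e'j: "e' (residue m j) = e j" if "j \<in> {z + 1..<z + int m}" for j
    proof -
      have u: "upper_rep m z (residue m j) = j" using upper_rep_window[OF m, of j z] that by auto
      moreover have "upper_rep m z (residue m z) = z + int m" using upper_rep_window[OF m, of z z] by simp
      ultimately have "residue m j \<noteq> residue m z" using that by auto
      then show ?thesis by (simp add: e'_def u)
    qed
    let ?F = "\<lambda>y. ennreal (if \<forall>j\<in>?W. 0 \<le> w y j then \<Prod>j\<in>?W. w y j ^ e j else 0)"
    have Fm: "?F \<in> borel_measurable (Pi\<^sub>M (insert n {..<n}) (\<lambda>_. lborel))"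
      unfolding lessThan_Suc[symmetric] by measurable
    have "?L = (\<integral>\<^sup>+y. ?F y \<partial>Pi\<^sub>M (insert n {..<n}) (\<lambda>_. lborel))"
      unfolding prodX unfolding XB by (simp add: \<beta>'B e_def lessThan_Suc cong: if_cong)
    also have "\<dots> = (\<integral>\<^sup>+x. \<integral>\<^sup>+t. ?F (x(n := t)) \<partial>lborel \<partial>?P n)"
      by (rule product_nn_integral_insert[OF _ _ Fm]) auto
    also have "\<dots> = (\<integral>\<^sup>+x. ennreal (\<bar>q\<bar> * real m * ?c) *
        ennreal (if \<forall>v\<in>V. 0 \<le> \<beta> v x then \<Prod>v\<in>V. \<beta> v x ^ e' (col v) else 0) \<partial>?P n)"
    proof (rule nn_integral_cong)
      fix x assume "x \<in> space (?P n)"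
      then have "restrict (x(n := t)) {..<n} = x" for t
        by (auto simp: space_PiM PiE_def extensional_def fun_eq_iff)
      then have wx: "w (x(n := t)) = prism_weight m (\<lambda>i. \<beta> (A i) x) z (t / q)" for t
        by (simp add: w_def)
      have "(\<integral>\<^sup>+t. ?F (x(n := t)) \<partial>lborel) = ennreal (\<bar>q\<bar> * real m * ?c) *
          ennreal (if \<forall>i<m. 0 \<le> \<beta> (A i) x then \<Prod>i<m. \<beta> (A i) x ^ e' i else 0)"
        unfolding wx by (rule nn_integral_prism_weight[OF m q e'0 e'j])
      moreover have "(\<forall>i<m. 0 \<le> \<beta> (A i) x) \<longleftrightarrow> (\<forall>v\<in>V. 0 \<le> \<beta> v x)"
        using AV coloured_label_col[OF col] unfolding A_def m_def by metis
      moreover have "(\<Prod>i<m. \<beta> (A i) x ^ e' i) = (\<Prod>v\<in>V. \<beta> v x ^ e' (col v))"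
        unfolding A_def m_def by (rule coloured_prod[OF col])
      ultimately show "(\<integral>\<^sup>+t. ?F (x(n := t)) \<partial>lborel) = ennreal (\<bar>q\<bar> * real m * ?c) *
          ennreal (if \<forall>v\<in>V. 0 \<le> \<beta> v x then \<Prod>v\<in>V. \<beta> v x ^ e' (col v) else 0)" by simp
    qed
    also have "\<dots> = ennreal (\<bar>q\<bar> * real m * ?c) *
        ennreal (M * fact n * (\<Prod>v\<in>V. fact (e' (col v))) / fact (n + (\<Sum>v\<in>V. e' (col v))))"
      using bm coloured_finite[OF col] by (subst nn_integral_cmult) (auto simp: mo)
    also have "\<dots> = ennreal (\<bar>q\<bar> * real m * ?c *
        (M * fact n * (\<Prod>v\<in>V. fact (e' (col v))) / fact (n + (\<Sum>v\<in>V. e' (col v)))))"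
      using M by (intro ennreal_mult[symmetric]) (auto intro!: prod_nonneg divide_nonneg_nonneg mult_nonneg_nonneg)
    also have "\<bar>q\<bar> * real m * ?c *
        (M * fact n * (\<Prod>v\<in>V. fact (e' (col v))) / fact (n + (\<Sum>v\<in>V. e' (col v)))) =
        M * \<bar>q\<bar> * fact (Suc n) * (\<Prod>v\<in>?X. fact (a v)) / fact (Suc n + (\<Sum>v\<in>?X. a v))"
    proof -
      \<comment> \<open>The factorial in the denominator of the Beta integral cancels that of the
        merged exponent, whose extra 1 turns n into n + 1 in the final denominator; m times n! is (n
        + 1)!.\<close>
      define F S where "F = (\<Prod>j\<in>{z + 1..<z + int m}. fact (e j) :: real)" and "S = (\<Sum>j\<in>{z + 1..<z + int m}. e j)"
      have "(\<Prod>v\<in>V. fact (e' (col v)) :: real) = fact (e z + e (z + int m) + 1) * F"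
        using coloured_prod[OF col, of "\<lambda>i _. fact (e' i) :: real"] prod_residue[OF m, of "\<lambda>i. fact (e' i) :: real" z]
        by (simp add: e'0 e'j F_def m_def[symmetric] del: fact_Suc)
      moreover have "(\<Sum>v\<in>V. e' (col v)) = e z + e (z + int m) + 1 + S"
        using coloured_sum[OF col, of "\<lambda>i _. e' i"] sum_residue[OF m, of e' z]
        by (simp add: e'0 e'j S_def m_def[symmetric])
      moreover have "(\<Prod>v\<in>?X. fact (a v) :: real) = fact (e z) * fact (e (z + int m)) * F"
        unfolding prodX prod_window[OF m] by (simp add: e_def F_def)
      moreover have "(\<Sum>v\<in>?X. a v) = e z + e (z + int m) + S"
        unfolding sumXn sum_window[OF m] by (simp add: e_def S_def)
      moreover have "n + (e z + e (z + int m) + 1 + S) = Suc n + (e z + e (z + int m) + S)" by simp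
      moreover have "fact (Suc n) = real m * fact n" by (simp add: m_def)
      ultimately show ?thesis
        by (simp only:) (simp add: field_simps del: fact_Suc)
    qed
    finally show ?thesis .
  qed
  have "(\<forall>v\<in>?X. \<beta>' v \<in> borel_measurable (?P (Suc n))) \<and>
     (\<forall>y\<in>space (?P (Suc n)). (\<Sum>v\<in>?X. \<beta>' v y) = 1 \<and> (\<forall>i<Suc n. (\<Sum>v\<in>?X. \<beta>' v y * v i) = y i))"
    unfolding sumX unfolding XB using rec wm by (auto simp: \<beta>'B)
  then show ?thesis
    unfolding simplex_moments_def A_def[symmetric] using mom by blast
qed

text \<open>By affine independence the functions \<beta> are the only barycentric coordinates, so
  the simplex is where all of them are nonnegative. The moment with all exponents 0 is the measure
  of this set.\<close>

lemma meas_d_conv_pts: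
  assumes sm: "simplex_moments d V M" and V: "V \<subseteq> Rd d" "finite V" and ind: "aff_indep_pts V"
  shows "meas_d d (conv_pts V) = ennreal M"
proof -
  let ?P = "Pi\<^sub>M {..<d} (\<lambda>_. lborel :: real measure)"
  obtain \<beta> where bm[measurable]: "\<And>v. v \<in> V \<Longrightarrow> \<beta> v \<in> borel_measurable ?P"
    and one: "\<And>y. y \<in> space ?P \<Longrightarrow> (\<Sum>v\<in>V. \<beta> v y) = 1"
    and co: "\<And>y i. y \<in> space ?P \<Longrightarrow> i < d \<Longrightarrow> (\<Sum>v\<in>V. \<beta> v y * v i) = y i"
    and mo: "\<And>a. (\<integral>\<^sup>+y. ennreal (if \<forall>v\<in>V. 0 \<le> \<beta> v y then \<Prod>v\<in>V. \<beta> v y ^ a v else 0) \<partial>?P) =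
        ennreal (M * fact d * (\<Prod>v\<in>V. fact (a v)) / fact (d + (\<Sum>v\<in>V. a v)))"
    using sm unfolding simplex_moments_def by blast
  let ?S = "{y \<in> space ?P. \<forall>v\<in>V. 0 \<le> \<beta> v y}"
  have V0: "v i = 0" if "v \<in> V" "\<not> i < d" for v i using V that by (auto simp: Rd_def)
  have "(\<lambda>x. restrict x {..<d}) ` conv_pts V = ?S"
  proof (intro equalityI subsetI)
    fix y assume "y \<in> (\<lambda>x. restrict x {..<d}) ` conv_pts V"
    then obtain x u where y: "y = restrict x {..<d}" and u: "bary V u x" by (auto simp: conv_pts_bary)
    have sp: "y \<in> space ?P" by (simp add: y space_PiM)
    have "(\<Sum>v\<in>V. (u v - \<beta> v y) * v i) = 0" for i
    proof (cases "i < d")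
      case True
      then show ?thesis using co[OF sp True] u by (simp add: left_diff_distrib sum_subtractf y bary_def)
    next
      case False
      then show ?thesis using V0 by (intro sum.neutral) auto
    qed
    moreover have "(\<Sum>v\<in>V. u v - \<beta> v y) = 0"
      using one[OF sp] u by (simp add: sum_subtractf bary_def)
    ultimately have "\<forall>v\<in>V. u v - \<beta> v y = 0"
      using ind unfolding aff_indep_pts_def by blast
    then show "y \<in> ?S" using sp u by (auto simp: bary_def)
  next
    fix y assume y: "y \<in> ?S"
    define x where "x = (\<lambda>i. \<Sum>v\<in>V. \<beta> v y * v i)"
    have "bary V (\<lambda>v. \<beta> v y) x" using y one by (auto simp: bary_def x_def)
    moreover have "y = restrict x {..<d}"
      using y co by (auto simp: x_def fun_eq_iff space_PiM PiE_def extensional_def restrict_def)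
    ultimately show "y \<in> (\<lambda>x. restrict x {..<d}) ` conv_pts V"
      by (auto simp: conv_pts_bary)
  qed
  then have "meas_d d (conv_pts V) = emeasure ?P ?S" by (simp add: meas_d_def)
  also have "\<dots> = (\<integral>\<^sup>+y. indicator ?S y \<partial>?P)"
    using V(2) by (intro nn_integral_indicator[symmetric]) measurable
  also have "\<dots> = (\<integral>\<^sup>+y. ennreal (if \<forall>v\<in>V. 0 \<le> \<beta> v y then \<Prod>v\<in>V. \<beta> v y ^ 0 else 0) \<partial>?P)"
    by (intro nn_integral_cong) (auto simp: indicator_def)
  also have "\<dots> = ennreal M"
    unfolding mo by simp
  finally show ?thesis .
qed

section \<open>Consequences of uniqueness of weights\<close>

text \<open>Adding a small multiple of an affine dependence to the equal weights of the barycentre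
  gives nonnegative weights of the same point.\<close>

lemma unique_bary_aff_indep:
  assumes uni: "unique_bary T" and V: "V \<in> T" "finite V" "V \<noteq> {}"
  shows "aff_indep_pts V"
  unfolding aff_indep_pts_def
proof (intro allI impI ballI)
  fix u v assume u: "sum u V = 0 \<and> (\<forall>i. (\<Sum>v\<in>V. u v * v i) = 0)" and v: "v \<in> V"
  define c where "c = 1 / real (card V)"
  \<comment> \<open>Since s is at least every \<bar>u v\<bar>, the perturbation c / s * u v never
    falls below -c; the summand 1 keeps s positive.\<close>
  define s where "s = 1 + (\<Sum>v\<in>V. \<bar>u v\<bar>)"
  have c: "c > 0" using V by (simp add: c_def card_gt_0_iff)
  have s: "s > 0" unfolding s_def by (rule add_pos_nonneg) (auto intro: sum_nonneg)
  have cV: "(\<Sum>v\<in>V. c) = 1" using V by (simp add: c_def)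
  define x where "x = (\<lambda>i. \<Sum>v\<in>V. c * v i)"
  have "bary V (\<lambda>_. c) x" using c cV by (simp add: bary_def x_def)
  moreover have "bary V (\<lambda>v. c + c / s * u v) x"
  proof -
    have "0 \<le> c + c / s * u v" if "v \<in> V" for v
    proof -
      have "\<bar>u v\<bar> \<le> (\<Sum>v\<in>V. \<bar>u v\<bar>)"
        using V that by (intro member_le_sum) auto
      then have "- u v \<le> s" by (simp add: s_def)
      then have "c / s * (- u v) \<le> c / s * s" using c s by (intro mult_left_mono) auto
      then show ?thesis using s by simp
    qed
    moreover have "(\<Sum>v\<in>V. c + c / s * u v) = 1"
      unfolding sum.distrib sum_distrib_left[symmetric] cV using u by simp
    moreover have "(\<Sum>v\<in>V. (c + c / s * u v) * v i) = x i" for i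
      unfolding x_def distrib_right sum.distrib mult.assoc sum_distrib_left[symmetric, of "c / s"]
      using u by simp
    ultimately show ?thesis by (simp add: bary_def fun_eq_iff)
  qed
  ultimately have "c + c / s * u v = c"
    using uni V(1) v c unfolding unique_bary_def by fastforce
  then show "u v = 0" using c s by simp
qed

lemma conv_pts_mono:
  assumes "U \<subseteq> V" "finite V"
  shows "conv_pts U \<subseteq> conv_pts V"
proof
  fix x assume "x \<in> conv_pts U"
  then obtain u where u: "bary U u x" by (auto simp: conv_pts_bary)
  let ?u = "\<lambda>v. if v \<in> U then u v else 0"
  have "(\<Sum>v\<in>V. ?u v) = (\<Sum>v\<in>U. u v)"
    using assms by (intro sum.mono_neutral_cong_right) auto
  moreover have "(\<Sum>v\<in>V. ?u v * v i) = (\<Sum>v\<in>U. u v * v i)" for i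
    using assms by (intro sum.mono_neutral_cong_right) auto
  ultimately have "bary V ?u x" using u by (simp add: bary_def)
  then show "x \<in> conv_pts V" by (auto simp: conv_pts_bary)
qed

lemma conv_pts_subset_Rd: "V \<subseteq> Rd n \<Longrightarrow> conv_pts V \<subseteq> Rd n"
  by (auto simp: conv_pts_def Rd_def intro!: sum.neutral)

text \<open>For a common point, uniqueness makes the weight of every vertex outside the other
  simplex zero.\<close>

lemma unique_bary_Int:
  assumes uni: "unique_bary T" and VW: "V \<in> T" "W \<in> T" "finite V" "finite W"
  shows "conv_pts V \<inter> conv_pts W = conv_pts (V \<inter> W)"
proof
  show "conv_pts (V \<inter> W) \<subseteq> conv_pts V \<inter> conv_pts W"
    using VW by (simp add: conv_pts_mono)
  show "conv_pts V \<inter> conv_pts W \<subseteq> conv_pts (V \<inter> W)"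
  proof
    fix x assume "x \<in> conv_pts V \<inter> conv_pts W"
    then obtain u u' where b: "bary V u x" "bary W u' x" by (auto simp: conv_pts_bary)
    then have z: "u v = 0" if "v \<in> V - W" for v
      using uni VW that unfolding unique_bary_def by blast
    have "sum u (V \<inter> W) = sum u V"
      using VW z by (intro sum.mono_neutral_left) auto
    moreover have "(\<Sum>v\<in>V \<inter> W. u v * v i) = (\<Sum>v\<in>V. u v * v i)" for i
      using VW z by (intro sum.mono_neutral_left) auto
    ultimately have "bary (V \<inter> W) u x" using b(1) by (simp add: bary_def)
    then show "x \<in> conv_pts (V \<inter> W)" by (auto simp: conv_pts_bary)
  qed
qed

lemma unique_bary_interiors_disjoint:
  assumes uni: "unique_bary T" and VW: "V \<in> T" "W \<in> T" and fin: "finite V" and Rd: "V \<subseteq> Rd d"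
    and v: "v \<in> V" "v \<notin> W"
  shows "int_d d (conv_pts V) \<inter> int_d d (conv_pts W) = {}"
proof (rule ccontr)
  assume "\<not> ?thesis"
  then obtain x U U' where U: "openin (top_of_set (Rd d)) U" "U \<subseteq> conv_pts V" "x \<in> U"
    and U': "openin (top_of_set (Rd d)) U'" "U' \<subseteq> conv_pts W" "x \<in> U'"
    by (auto simp: int_d_def)
  obtain G where G: "open G" "U \<inter> U' = Rd d \<inter> G"
    using openin_Int[OF U(1) U'(1)] by (auto simp: openin_open)
  have x: "x \<in> Rd d" "x \<in> G" using G U(3) U'(3) by auto
  \<comment> \<open>The segment from x towards v starts in the open set G, so for small positive
    parameters it stays in both hulls.\<close>
  define f where "f = (\<lambda>\<epsilon>::real. \<lambda>i. x i + \<epsilon> * (v i - x i))"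
  have "continuous_on UNIV f"
    unfolding f_def by (intro continuous_on_coordinatewise_then_product continuous_intros)
  then have "open (f -` G)" using G(1) by (simp add: open_vimage)
  moreover have "0 \<in> f -` G" using x by (simp add: f_def)
  ultimately obtain e where e: "e > 0" "ball 0 e \<subseteq> f -` G" by (meson openE)
  define \<epsilon> where "\<epsilon> = min (e / 2) (1 / 2)"
  have \<epsilon>: "0 < \<epsilon>" "\<epsilon> < 1" "\<epsilon> \<in> ball 0 e" using e(1) by (auto simp: \<epsilon>_def min_def)
  have "f \<epsilon> \<in> Rd d" using x(1) Rd v(1) by (auto simp: f_def Rd_def)
  then have "f \<epsilon> \<in> U \<inter> U'" using G(2) e(2) \<epsilon>(3) by auto
  then obtain u' where u': "bary W u' (f \<epsilon>)" using U' by (auto simp: conv_pts_bary)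
  obtain u where u: "bary V u x" using U by (auto simp: conv_pts_bary)
  \<comment> \<open>The moved point has weight at least \<epsilon> at v, and uniqueness then forces
    v into W.\<close>
  let ?w = "\<lambda>y. (1 - \<epsilon>) * u y + (if y = v then \<epsilon> else 0)"
  have "bary V ?w (f \<epsilon>)"
  proof -
    have "sum ?w V = 1"
      unfolding sum.distrib sum_distrib_left[symmetric] using u v(1) fin by (simp add: bary_def)
    moreover have "(\<Sum>y\<in>V. ?w y * y i) = f \<epsilon> i" for i
    proof -
      have "(\<Sum>y\<in>V. ?w y * y i) = (1 - \<epsilon>) * (\<Sum>y\<in>V. u y * y i) + (\<Sum>y\<in>V. if y = v then \<epsilon> * v i else 0)"
        unfolding sum_distrib_left sum.distrib[symmetric] by (intro sum.cong) (auto simp: algebra_simps)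
      also have "\<dots> = f \<epsilon> i" using u v(1) fin by (simp add: bary_def f_def algebra_simps)
      finally show ?thesis .
    qed
    ultimately show ?thesis using u \<epsilon> by (auto simp: bary_def fun_eq_iff)
  qed
  moreover have "?w v \<noteq> 0"
  proof -
    have "0 \<le> (1 - \<epsilon>) * u v" using u v(1) \<epsilon> by (simp add: bary_def)
    then show ?thesis using \<epsilon> by simp
  qed
  ultimately have "v \<in> W" using uni VW u' v(1) unfolding unique_bary_def by blast
  then show False using v by simp
qed

section \<open>Induction over the dimension and the conclusion\<close>

definition tess_invariant :: "nat \<Rightarrow> ((nat \<Rightarrow> real) \<Rightarrow> nat) \<Rightarrow> (nat \<Rightarrow> real) set set \<Rightarrow> real \<Rightarrow> bool" where
  "tess_invariant n col T M \<longleftrightarrow> (\<forall>V\<in>T. coloured n col V \<and> simplex_moments n V M) \<and>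
     unique_bary T \<and> Rd n \<subseteq> (\<Union>V\<in>T. conv_pts V)"

lemma tess_invariant_origin: "tess_invariant 0 (\<lambda>_. 0) {{\<lambda>_. 0}} 1"
proof -
  have "Rd 0 = {\<lambda>_. 0}" by (auto simp: Rd_def)
  then show ?thesis
    using simplex_moments_origin
    by (auto simp: tess_invariant_def coloured_def bij_betw_def unique_bary_def bary_def conv_pts_def
        intro!: exI[of _ "\<lambda>_. 1"])
qed

lemma tess_invariant_prism:
  assumes "tess_invariant n col T M" "q \<noteq> 0" "0 \<le> M"
  shows "tess_invariant (Suc n) (\<lambda>x. residue (Suc (Suc n)) (round (x n / q))) (prism_tess n q col T) (M * \<bar>q\<bar>)"
proof -
  have T: "\<And>V. V \<in> T \<Longrightarrow> coloured n col V" "\<And>V. V \<in> T \<Longrightarrow> simplex_moments n V M"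
    and uc: "unique_bary T" "Rd n \<subseteq> (\<Union>V\<in>T. conv_pts V)"
    using assms(1) by (auto simp: tess_invariant_def)
  have "coloured (Suc n) (\<lambda>x. residue (Suc (Suc n)) (round (x n / q))) X \<and> simplex_moments (Suc n) X (M * \<bar>q\<bar>)"
    if "X \<in> prism_tess n q col T" for X
    using that coloured_prism_simplex[OF assms(2) T(1)] simplex_moments_prism[OF assms(2) T(1) assms(3) T(2)]
    by (auto simp: prism_tess_def)
  then show ?thesis
    unfolding tess_invariant_def
    using unique_bary_prism_tess[OF assms(2) T(1) uc(1)] prism_tess_cover[OF assms(2) T(1) uc(2)] by blast
qed

text \<open>Only the labelling involves colours, and a bijection followed by a permutation is again
  one.\<close>

lemma tess_invariant_permute:
  assumes "tess_invariant n col T M" "\<sigma> permutes {..<Suc n}"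
  shows "tess_invariant n (\<lambda>x. \<sigma> (col x)) T M"
  using assms bij_betw_trans[OF _ permutes_imp_bij[OF assms(2)]]
  by (auto simp: tess_invariant_def coloured_def o_def)

text \<open>For n = 0 the modulus is 1, so every index lifts the single base point and a window
  consists of z and z + 1.\<close>

lemma tess_vs_1: "tess_vs p \<pi> (Suc 0) = prism_tess 0 (p 1) (\<lambda>_. 0) {{\<lambda>_. 0}}"
proof -
  have A: "the_inv_into {\<lambda>_::nat. 0::real} (\<lambda>_. 0::nat) 0 = (\<lambda>_. 0)"
    by (simp add: the_inv_into_def)
  have "{z..z + 1} = {z, z + 1}" for z :: int by auto
  then have "prism_simplex 0 (p 1) (the_inv_into {\<lambda>_. 0} (\<lambda>_. 0)) z =
      {(\<lambda>i. if i = 0 then real_of_int z * p 1 else 0), (\<lambda>i. if i = 0 then real_of_int (z + 1) * p 1 else 0)}" for z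
    by (auto simp: prism_simplex_def prism_vertex_def residue_def A fun_eq_iff)
  then show ?thesis by (simp add: prism_tess_def)
qed

text \<open>\<open>lab_vtx\<close> and \<open>the_inv_into\<close> unfold to the same definite
  description.\<close>

lemma tess_vs_Suc:
  "tess_vs p \<pi> (Suc (Suc k)) = prism_tess (Suc k) (p (Suc (Suc k)))
     (\<lambda>x. \<pi> (Suc (Suc k)) (vcol p (Suc k) x)) (tess_vs p \<pi> (Suc k))"
proof -
  have "prism_simplex (Suc k) (p (Suc (Suc k))) (the_inv_into K (\<lambda>x. \<pi> (Suc (Suc k)) (vcol p (Suc k) x))) z =
      {(lab_vtx p \<pi> (Suc (Suc k)) K (nat (j mod int (Suc (Suc k)))))
          (Suc k := real_of_int j * p (Suc (Suc k))) | j. z \<le> j \<and> j \<le> z + int (Suc (Suc k))}" for K z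
    unfolding prism_simplex_def prism_vertex_def the_inv_into_def lab_vtx_def residue_def diff_Suc_1
    by (auto simp del: of_nat_Suc)
  then show ?thesis by (simp only: tess_vs.simps prism_tess_def)
qed

lemma vcol_Suc: "vcol p (Suc n) = (\<lambda>x. residue (Suc (Suc n)) (round (x n / p (Suc n))))"
  by (simp add: vcol_def residue_def fun_eq_iff ac_simps)

lemma tess_vs_invariant:
  assumes "\<forall>i\<in>{1..Suc k}. p i \<noteq> 0" "\<forall>i\<in>{2..Suc k}. \<pi> i permutes {..<i}"
  shows "tess_invariant (Suc k) (vcol p (Suc k)) (tess_vs p \<pi> (Suc k)) (\<Prod>i=1..Suc k. \<bar>p i\<bar>)"
  using assms
proof (induction k)
  case 0
  then show ?case
    using tess_invariant_prism[OF tess_invariant_origin, of "p 1"]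
    unfolding tess_vs_1 vcol_Suc by simp
next
  case (Suc k)
  let ?\<sigma> = "\<pi> (Suc (Suc k))" and ?q = "p (Suc (Suc k))"
  have perm: "?\<sigma> permutes {..<Suc (Suc k)}" and q: "?q \<noteq> 0"
    using Suc.prems by (simp_all del: lessThan_Suc)
  have "tess_invariant (Suc k) (vcol p (Suc k)) (tess_vs p \<pi> (Suc k)) (\<Prod>i=1..Suc k. \<bar>p i\<bar>)"
    by (rule Suc.IH) (use Suc.prems in auto)
  from tess_invariant_prism[OF tess_invariant_permute[OF this perm] q]
  have "tess_invariant (Suc (Suc k)) (vcol p (Suc (Suc k))) (tess_vs p \<pi> (Suc (Suc k)))
      ((\<Prod>i=1..Suc k. \<bar>p i\<bar>) * \<bar>?q\<bar>)"
    unfolding tess_vs_Suc vcol_Suc[of p "Suc k"] by (simp only: prod_nonneg abs_ge_zero)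
  then show ?case by (simp add: mult.commute)
qed

theorem theorem2:
  fixes d :: nat and p :: "nat \<Rightarrow> real" and \<pi> :: "nat \<Rightarrow> nat \<Rightarrow> nat"
  assumes "d \<ge> 1"
    and "\<forall>i\<in>{1..d}. p i \<noteq> 0"
    and "\<forall>i\<in>{2..d}. \<pi> i permutes {..<i}"
  shows "simplicial_tessellation d (tess p \<pi> d)
    \<and> (\<forall>K\<in>tess p \<pi> d. meas_d d K = ennreal (\<Prod>i=1..d. \<bar>p i\<bar>))
    \<and> (\<forall>S. S \<subseteq> tess p \<pi> d \<and> finite S \<and> connected (\<Union>S) \<longrightarrow> face_to_face S)"
proof -
  define T where "T = tess_vs p \<pi> d"
  have "tess_invariant d (vcol p d) T (\<Prod>i=1..d. \<bar>p i\<bar>)"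
    using tess_vs_invariant[of "d - 1" p \<pi>] assms by (simp add: T_def)
  then have col: "\<And>V. V \<in> T \<Longrightarrow> coloured d (vcol p d) V"
    and mom: "\<And>V. V \<in> T \<Longrightarrow> simplex_moments d V (\<Prod>i=1..d. \<bar>p i\<bar>)"
    and uni: "unique_bary T" and cover: "Rd d \<subseteq> (\<Union>V\<in>T. conv_pts V)"
    by (auto simp: tess_invariant_def)
  have fin: "finite V" if "V \<in> T" for V using coloured_finite[OF col[OF that]] .
  have card: "card V = d + 1" if "V \<in> T" for V
    using col[OF that] bij_betw_same_card by (fastforce simp: coloured_def)
  have Rd: "V \<subseteq> Rd d" if "V \<in> T" for V using col[OF that] by (simp add: coloured_def)
  have ind: "aff_indep_pts V" if "V \<in> T" for V
    using card[OF that] by (intro unique_bary_aff_indep[OF uni that fin[OF that]]) auto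
  have tess: "tess p \<pi> d = conv_pts ` T" by (simp add: tess_def T_def)
  have "int_d d (conv_pts V) \<inter> int_d d (conv_pts W) = {}"
    if VW: "V \<in> T" "W \<in> T" and "conv_pts V \<noteq> conv_pts W" for V W
  proof -
    \<comment> \<open>Both vertex sets have d + 1 elements, so inclusion would make them
      equal.\<close>
    have "\<not> V \<subseteq> W"
      using card_subset_eq[OF fin[OF VW(2)], of V] card VW \<open>conv_pts V \<noteq> conv_pts W\<close> by auto
    then obtain v where "v \<in> V" "v \<notin> W" by blast
    then show ?thesis by (rule unique_bary_interiors_disjoint[OF uni VW fin[OF VW(1)] Rd[OF VW(1)]])
  qed
  moreover have "(\<Union>V\<in>T. conv_pts V) = Rd d"
    using cover conv_pts_subset_Rd[OF Rd] by blast
  moreover have "is_simplex d (conv_pts V)" if "V \<in> T" for V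
    unfolding is_simplex_def using fin card Rd ind that by blast
  ultimately have "simplicial_tessellation d (tess p \<pi> d)"
    unfolding simplicial_tessellation_def tess by auto
  moreover have "meas_d d (conv_pts V) = ennreal (\<Prod>i=1..d. \<bar>p i\<bar>)" if "V \<in> T" for V
    using meas_d_conv_pts[OF mom Rd fin ind] that by blast
  moreover have "conv_pts V \<inter> conv_pts W = {} \<or>
      simplex_face (conv_pts V \<inter> conv_pts W) (conv_pts V) \<and> simplex_face (conv_pts V \<inter> conv_pts W) (conv_pts W)"
    if VW: "V \<in> T" "W \<in> T" for V W
  proof (cases "V \<inter> W = {}")
    case True
    \<comment> \<open>The hull of the empty set is empty because an empty sum of weights is not
      1.\<close>
    then show ?thesis using unique_bary_Int[OF uni VW fin fin] VW by (simp add: conv_pts_def)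
  next
    case False
    have "conv_pts V \<inter> conv_pts W = conv_pts (V \<inter> W)"
      using unique_bary_Int[OF uni VW fin fin] VW by simp
    then show ?thesis
      unfolding simplex_face_def using False fin ind VW by (metis Int_lower1 Int_lower2)
  qed
  ultimately show ?thesis
    unfolding tess face_to_face_def by (smt (verit) image_iff subset_iff)
qed

end
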